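(* Let $\hat\phi^h\in\widetilde D(\partial\Omega)$. Let $\boldsymbol q^h\in D(\Omega)$ be the solution of the discrete Neumann problem $$(\mathrm{div}\,\boldsymbol p^h,\mathrm{div}\,\boldsymbol q^h)_{L^2(\Omega)}+(\boldsymbol p^h,\boldsymbol q^h)_{L^2(\Omega)}=\int_{\partial\Omega}(\boldsymbol p^h\cdot\boldsymbol n)\,\hat\phi^h\,\mathrm d\Gamma\qquad\forall\,\boldsymbol p^h\in D(\Omega),$$ and let $\phi^h\in\widetilde S(\Omega)$ be the solution of the discrete Dirichlet problem $$\big(\widetilde{\mathrm{grad}}(\varphi^h,0),\widetilde{\mathrm{grad}}(\phi^h,\hat\phi^h)\big)_{L^2(\Omega)}+(\varphi^h,\phi^h)_{L^2(\Omega)}=0\qquad\forall\,\varphi^h\in\widetilde S(\Omega).$$ Then $\phi^h=\mathrm{div}\,\boldsymbol q^h$ identically in $\Omega$, i.e. $\widetilde{\mathcal N}^0(\phi^h)=\mathbb M^{(2)}\mathbb E^{2,1}\mathcal N^1(\boldsymbol q^h)$. Moreover $$\|\hat\phi^h\|_{\widetilde D(\partial\Omega)}=\|(\phi^h,\hat\phi^h)\|_{H(\widetilde{\mathrm{grad}};\Omega)}=\|\boldsymbol q^h\|_{H(\mathrm{div};\Omega)}.$$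
   Context: Reference element. Fix $N\ge1$; let $-1=\xi_0<\dots<\xi_N=1$ be the Gauss–Lobatto–Legendre (GLL) nodes, i.e. the roots of $(1-\xi^2)L_N'(\xi)$, $L_N$ the Legendre polynomial of degree $N$. Let $\mathcal P$, $\mathcal Q$ be the polynomials on $[-1,1]$ of degree at most $N$, $N-1$ respectively. On $K=[-1,1]^2$ set $D(K)=(\mathcal P\otimes\mathcal Q)\times(\mathcal Q\otimes\mathcal P)$ and $S(K)=\mathcal Q\otimes\mathcal Q$. Mesh and primal spaces. $\Omega\subset\mathbb R^2$ is a bounded Lipschitz domain with outward unit normal $\boldsymbol n$, partitioned into conforming non-overlapping elements $\Omega_m=\Phi_m(K)$, with $\Phi_m$ diffeomorphisms with Jacobian matrix $\mathsf J$ ($\det\mathsf J>0$), such that the global map is continuous; the images of the GLL grid form a global mesh of small edges and cells. $D(\Omega)\subset H(\mathrm{div};\Omega)$ is the space of vector fields with continuous normal component across element boundaries that on each $\Omega_m$ have the form $\big(\frac{1}{\det\mathsf J}\mathsf J\bar{\boldsymbol u}\big)\circ\Phi_m^{-1}$ with $\bar{\boldsymbol u}\in D(K)$; $S(\Omega)\subset L^2(\Omega)$ is the space of functions that on each $\Omega_m$ have the form $\big(\frac1{\det\mathsf J}\bar g\big)\circ\Phi_m^{-1}$ with $\bar g\in S(K)$. Degrees of freedom. $\mathcal N^1(\boldsymbol q^h)$ is the column vector of fluxes of $\boldsymbol q^h\in D(\Omega)$ through the small edges (each with a fixed chosen unit normal), and $\mathcal N^2(p^h)$ the column vector of integrals of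 $p^h\in S(\Omega)$ over the small cells. $\Psi^1,\Psi^2$ are the row vectors of basis functions of $D(\Omega)$, $S(\Omega)$ with $\boldsymbol q^h=\Psi^1\mathcal N^1(\boldsymbol q^h)$, $p^h=\Psi^2\mathcal N^2(p^h)$. The incidence matrix $\mathbb E^{2,1}$ (entries $-1,0,1$) is defined by $\mathrm{div}\,\boldsymbol q^h=\Psi^2\mathbb E^{2,1}\mathcal N^1(\boldsymbol q^h)$ for all $\boldsymbol q^h\in D(\Omega)$. Mass matrices: $\mathbb M^{(k)}=\int_\Omega(\Psi^k)^\intercal\Psi^k\,\mathrm d\Omega$, $k=1,2$. Dual representations. $\widetilde\Psi^{2-k}=\Psi^k(\mathbb M^{(k)})^{-1}$ and $\widetilde{\mathcal N}^{2-k}(\cdot)=\mathbb M^{(k)}\mathcal N^k(\cdot)$. $\widetilde D(\Omega)$, $\widetilde S(\Omega)$ denote $D(\Omega)$, $S(\Omega)$ (the same sets of functions) with elements expanded in the dual bases $\widetilde\Psi^1$, $\widetilde\Psi^0$. Boundary. The inclusion matrix $\mathbb N_1$ has one row per small edge and one column per small edge contained in $\partial\Omega$; the column of a boundary edge has a single non-zero entry, in the row of that edge, equal to $+1$ if the chosen normal of that edge is outward and $-1$ otherwise. $\Psi_b^1=(\Psi^1\cdot\boldsymbol n)|_{\partial\Omega}\mathbb N_1$ is a basis of $D(\partial\Omega)=\{(\boldsymbol q^h\cdot\boldsymbol n)|_{\partial\Omega}:\boldsymbol q^h\in D(\Omega)\}$, with mass matrix $\mathbb M_b^{(1)}=\int_{\partial\Omega}(\Psi_b^1)^\intercal\Psi_b^1\,\mathrm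 d\Gamma$. $\widetilde D(\partial\Omega)$ is the space spanned by the dual basis $\widetilde\Psi_b^0=\Psi_b^1(\mathbb M_b^{(1)})^{-1}$, and $\hat s^h\in\widetilde D(\partial\Omega)$ has degrees of freedom $\widetilde{\mathcal B}^0(\hat s^h)=\int_{\partial\Omega}(\Psi_b^1)^\intercal\hat s^h\,\mathrm d\Gamma$, so $\hat s^h=\widetilde\Psi_b^0\widetilde{\mathcal B}^0(\hat s^h)$. Dual gradient. $\widetilde{\mathrm{grad}}:\widetilde S(\Omega)\times\widetilde D(\partial\Omega)\to\widetilde D(\Omega)$ is defined by $\int_\Omega\widetilde{\mathrm{grad}}(s^h,\hat s^h)\cdot\boldsymbol q^h\,\mathrm d\Omega=-\int_\Omega s^h\,\mathrm{div}\,\boldsymbol q^h\,\mathrm d\Omega+\int_{\partial\Omega}\hat s^h(\boldsymbol q^h\cdot\boldsymbol n)\,\mathrm d\Gamma$ for all $\boldsymbol q^h\in D(\Omega)$; equivalently $\widetilde{\mathrm{grad}}(s^h,\hat s^h)=\widetilde\Psi^1\big(-(\mathbb E^{2,1})^\intercal\widetilde{\mathcal N}^0(s^h)+\mathbb N_1\widetilde{\mathcal B}^0(\hat s^h)\big)$. Norms. $\|(s^h,\hat s^h)\|^2_{H(\widetilde{\mathrm{grad}};\Omega)}=\|s^h\|^2_{L^2(\Omega)}+\|\widetilde{\mathrm{grad}}(s^h,\hat s^h)\|^2_{L^2(\Omega)}$; $\|\hat s^h\|_{\widetilde D(\partial\Omega)}=\inf_{s^h\in\widetilde S(\Omega)}\|(s^h,\hat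 s^h)\|_{H(\widetilde{\mathrm{grad}};\Omega)}$; $\|\boldsymbol q^h\|^2_{H(\mathrm{div};\Omega)}=\|\boldsymbol q^h\|^2_{L^2(\Omega)}+\|\mathrm{div}\,\boldsymbol q^h\|^2_{L^2(\Omega)}$. *)

theory Defs
  imports "HOL-Analysis.Analysis" "HOL-Computational_Algebra.Polynomial"
begin

section \<open>Reference element\<close>

text \<open>Legendre polynomials by Rodrigues' formula.\<close>

definition legendre :: "nat \<Rightarrow> real poly" where
  "legendre n = smult (1 / (2 ^ n * fact n)) ((pderiv ^^ n) ([:-1, 0, 1:] ^ n))"

definition gll_nodes :: "nat \<Rightarrow> (nat \<Rightarrow> real) \<Rightarrow> bool" where
  "gll_nodes N xi \<longleftrightarrow>
     strict_mono_on {..N} xi \<and> xi 0 = -1 \<and> xi N = 1 \<and>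
     xi ` {..N} = {x. (1 - x\<^sup>2) * poly (pderiv (legendre N)) x = 0}"

definition refK :: "(real^2) set" where
  "refK = cbox (-1) 1"

definition ref_vertices :: "(real^2) set" where
  "ref_vertices = {v. \<forall>i. v $ i = -1 \<or> v $ i = 1}"

text \<open>A side of the reference square is identified by its outward unit normal.\<close>

definition ref_normals :: "(real^2) set" where
  "ref_normals = Basis \<union> uminus ` Basis"

definition ref_side :: "real^2 \<Rightarrow> (real^2) set" where
  "ref_side a = {x \<in> refK. x \<bullet> a = 1}"

definition rot90 :: "real^2 \<Rightarrow> real^2" where
  "rot90 a = vector [- (a $ 2), a $ 1]"

text \<open>Tensor product of the polynomials of degree at most \<open>k\<close> in the first variable and
  of degree at most \<open>l\<close> in the second one.\<close>

definition tensor_poly :: "nat \<Rightarrow> nat \<Rightarrow> (real^2 \<Rightarrow> real) set" where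
  "tensor_poly k l = {f. \<exists>c. \<forall>x. f x = (\<Sum>i\<le>k. \<Sum>j\<le>l. c i j * (x $ 1) ^ i * (x $ 2) ^ j)}"

definition DK :: "nat \<Rightarrow> (real^2 \<Rightarrow> real^2) set" where
  "DK N = {u. (\<lambda>x. u x $ 1) \<in> tensor_poly N (N - 1) \<and> (\<lambda>x. u x $ 2) \<in> tensor_poly (N - 1) N}"

definition SK :: "nat \<Rightarrow> (real^2 \<Rightarrow> real) set" where
  "SK N = tensor_poly (N - 1) (N - 1)"

definition ref_edges :: "nat \<Rightarrow> (nat \<Rightarrow> real) \<Rightarrow> (real^2) set set" where
  "ref_edges N xi =
     {{x. x $ 1 = xi i \<and> x $ 2 \<in> {xi j .. xi (Suc j)}} | i j. i \<le> N \<and> j < N} \<union>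
     {{x. x $ 2 = xi i \<and> x $ 1 \<in> {xi j .. xi (Suc j)}} | i j. i \<le> N \<and> j < N}"

definition ref_cells :: "nat \<Rightarrow> (nat \<Rightarrow> real) \<Rightarrow> (real^2) set set" where
  "ref_cells N xi =
     {{x. x $ 1 \<in> {xi i .. xi (Suc i)} \<and> x $ 2 \<in> {xi j .. xi (Suc j)}} | i j. i < N \<and> j < N}"


section \<open>Domain and mesh\<close>

definition lipschitz_domain :: "(real^2) set \<Rightarrow> bool" where
  "lipschitz_domain \<Omega> \<longleftrightarrow>
     open \<Omega> \<and> connected \<Omega> \<and> bounded \<Omega> \<and> \<Omega> \<noteq> {} \<and>
     (\<forall>x \<in> frontier \<Omega>. \<exists>U R L \<gamma>.
        open U \<and> x \<in> U \<and> orthogonal_transformation (R :: real^2 \<Rightarrow> real^2) \<and>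
        L-lipschitz_on UNIV (\<gamma> :: real \<Rightarrow> real) \<and>
        \<Omega> \<inter> U = {y \<in> U. R y $ 2 > \<gamma> (R y $ 1)})"

text \<open>\<open>k\<close> times continuously differentiable on an open set.\<close>

primrec Ck_on :: "nat \<Rightarrow> (real^2) set \<Rightarrow> (real^2 \<Rightarrow> real^2) \<Rightarrow> bool" where
  "Ck_on 0 U f \<longleftrightarrow> continuous_on U f"
| "Ck_on (Suc k) U f \<longleftrightarrow>
     (\<forall>x \<in> U. f differentiable (at x)) \<and>
     (\<forall>v. Ck_on k U (\<lambda>x. frechet_derivative f (at x) v))"

text \<open>Diffeomorphisms of a closed set, smooth up to its boundary.\<close>

definition smooth_diffeo_on :: "(real^2) set \<Rightarrow> (real^2 \<Rightarrow> real^2) \<Rightarrow> bool" where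
  "smooth_diffeo_on A f \<longleftrightarrow>
     (\<exists>U V g. open U \<and> open V \<and> A \<subseteq> U \<and> homeomorphism U V f g \<and>
        (\<forall>k. Ck_on k U f) \<and> (\<forall>k. Ck_on k V g))"

definition jac :: "('m \<Rightarrow> real^2 \<Rightarrow> real^2) \<Rightarrow> 'm \<Rightarrow> real^2 \<Rightarrow> real^2^2" where
  "jac \<Phi> m x = matrix (frechet_derivative (\<Phi> m) (at x))"

definition elt :: "('m \<Rightarrow> real^2 \<Rightarrow> real^2) \<Rightarrow> 'm \<Rightarrow> (real^2) set" where
  "elt \<Phi> m = \<Phi> m ` refK"

definition open_elt :: "('m \<Rightarrow> real^2 \<Rightarrow> real^2) \<Rightarrow> 'm \<Rightarrow> (real^2) set" where
  "open_elt \<Phi> m = \<Phi> m ` interior refK"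

text \<open>Discrete functions are only determined off the element interfaces (a null set), that is,
  on the following set.\<close>

definition broken :: "('m \<Rightarrow> real^2 \<Rightarrow> real^2) \<Rightarrow> (real^2) set" where
  "broken \<Phi> = (\<Union>m. open_elt \<Phi> m)"

text \<open>In \<open>conforming\<close>, two elements meet only in common vertices and in common whole sides, and
  on a common side both parametrisations agree up to orientation; this is the continuity of the
  global map and makes the GLL grids match.\<close>

definition conforming :: "('m \<Rightarrow> real^2 \<Rightarrow> real^2) \<Rightarrow> bool" where
  "conforming \<Phi> \<longleftrightarrow>
     (\<forall>m m'. m \<noteq> m' \<longrightarrow> (\<forall>x \<in> elt \<Phi> m \<inter> elt \<Phi> m'.
        (\<exists>v \<in> ref_vertices. \<exists>v' \<in> ref_vertices. x = \<Phi> m v \<and> x = \<Phi> m' v') \<or>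
        (\<exists>a \<in> ref_normals. \<exists>a' \<in> ref_normals. \<exists>\<epsilon> \<in> {-1, 1}.
           x \<in> \<Phi> m ` ref_side a \<and>
           (\<forall>t \<in> {-1..1}. \<Phi> m (a + t *\<^sub>R rot90 a) = \<Phi> m' (a' + (\<epsilon> * t) *\<^sub>R rot90 a')))))"

definition mesh :: "(real^2) set \<Rightarrow> ('m::finite \<Rightarrow> real^2 \<Rightarrow> real^2) \<Rightarrow> bool" where
  "mesh \<Omega> \<Phi> \<longleftrightarrow>
     (\<forall>m. smooth_diffeo_on refK (\<Phi> m)) \<and>
     (\<forall>m. \<forall>x \<in> refK. det (jac \<Phi> m x) > 0) \<and>
     (\<forall>m. open_elt \<Phi> m \<subseteq> \<Omega>) \<and>
     (\<forall>m m'. m \<noteq> m' \<longrightarrow> open_elt \<Phi> m \<inter> open_elt \<Phi> m' = {}) \<and>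
     closure \<Omega> = (\<Union>m. elt \<Phi> m) \<and>
     conforming \<Phi>"

definition small_edges :: "nat \<Rightarrow> (nat \<Rightarrow> real) \<Rightarrow> ('m \<Rightarrow> real^2 \<Rightarrow> real^2) \<Rightarrow> (real^2) set set" where
  "small_edges N xi \<Phi> = {\<Phi> m ` e | m e. e \<in> ref_edges N xi}"

definition small_cells :: "nat \<Rightarrow> (nat \<Rightarrow> real) \<Rightarrow> ('m \<Rightarrow> real^2 \<Rightarrow> real^2) \<Rightarrow> (real^2) set set" where
  "small_cells N xi \<Phi> = {\<Phi> m ` c | m c. c \<in> ref_cells N xi}"

definition vertices :: "('m \<Rightarrow> real^2 \<Rightarrow> real^2) \<Rightarrow> (real^2) set" where
  "vertices \<Phi> = (\<Union>m. \<Phi> m ` ref_vertices)"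


section \<open>Integrals over arcs, normals and traces\<close>

definition regular_param :: "(real \<Rightarrow> real^2) \<Rightarrow> (real^2) set \<Rightarrow> bool" where
  "regular_param g C \<longleftrightarrow>
     inj_on g {0..1} \<and> g ` {0..1} = C \<and>
     (\<forall>t \<in> {0..1}. g differentiable (at t within {0..1})) \<and>
     (\<forall>t \<in> {0..1}. vector_derivative g (at t within {0..1}) \<noteq> 0) \<and>
     continuous_on {0..1} (\<lambda>t. vector_derivative g (at t within {0..1}))"

text \<open>Integral with respect to arc length over a simple regular arc; its value does not depend on
  the chosen parametrisation.\<close>

definition arc_integral :: "(real^2) set \<Rightarrow> (real^2 \<Rightarrow> real) \<Rightarrow> real" where
  "arc_integral C f =
     (let g = (SOME g. regular_param g C)
      in LINT t:{0..1}|lebesgue. f (g t) * norm (vector_derivative g (at t within {0..1})))"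

definition unit_normal_field :: "(real^2) set \<Rightarrow> (real^2 \<Rightarrow> real^2) \<Rightarrow> bool" where
  "unit_normal_field C \<nu> \<longleftrightarrow>
     continuous_on C \<nu> \<and> (\<forall>x \<in> C. norm (\<nu> x) = 1) \<and>
     (\<forall>g. regular_param g C \<longrightarrow>
        (\<forall>t \<in> {0..1}. \<nu> (g t) \<bullet> vector_derivative g (at t within {0..1}) = 0))"

text \<open>Value at a point of the closed element \<open>m\<close>, taken from inside that element.\<close>

definition elt_trace :: "('m \<Rightarrow> real^2 \<Rightarrow> real^2) \<Rightarrow> 'm \<Rightarrow> (real^2 \<Rightarrow> real^2) \<Rightarrow> real^2 \<Rightarrow> real^2" where
  "elt_trace \<Phi> m q x = Lim (at x within open_elt \<Phi> m) q"

text \<open>Outward unit normal of element \<open>m\<close> on the image of the reference side with normal \<open>a\<close>.\<close>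

definition elt_normal :: "('m \<Rightarrow> real^2 \<Rightarrow> real^2) \<Rightarrow> 'm \<Rightarrow> real^2 \<Rightarrow> real^2 \<Rightarrow> real^2" where
  "elt_normal \<Phi> m a x = sgn (transpose (matrix_inv (jac \<Phi> m (inv_into refK (\<Phi> m) x))) *v a)"

text \<open>A point of the boundary of the domain which is not an element vertex lies on exactly one
  side of exactly one element.\<close>

definition bnd_side :: "('m \<Rightarrow> real^2 \<Rightarrow> real^2) \<Rightarrow> real^2 \<Rightarrow> 'm \<times> (real^2)" where
  "bnd_side \<Phi> x = (SOME (m, a). a \<in> ref_normals \<and> x \<in> \<Phi> m ` ref_side a)"

definition outer_normal :: "('m \<Rightarrow> real^2 \<Rightarrow> real^2) \<Rightarrow> real^2 \<Rightarrow> real^2" where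
  "outer_normal \<Phi> x = (case bnd_side \<Phi> x of (m, a) \<Rightarrow> elt_normal \<Phi> m a x)"

definition normal_trace :: "('m \<Rightarrow> real^2 \<Rightarrow> real^2) \<Rightarrow> (real^2 \<Rightarrow> real^2) \<Rightarrow> real^2 \<Rightarrow> real" where
  "normal_trace \<Phi> q x = elt_trace \<Phi> (fst (bnd_side \<Phi> x)) q x \<bullet> outer_normal \<Phi> x"

definition bnd_edges ::
    "nat \<Rightarrow> (nat \<Rightarrow> real) \<Rightarrow> (real^2) set \<Rightarrow> ('m \<Rightarrow> real^2 \<Rightarrow> real^2) \<Rightarrow> (real^2) set set" where
  "bnd_edges N xi \<Omega> \<Phi> = {C \<in> small_edges N xi \<Phi>. C \<subseteq> frontier \<Omega>}"

definition bnd_integral ::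
    "nat \<Rightarrow> (nat \<Rightarrow> real) \<Rightarrow> (real^2) set \<Rightarrow> ('m \<Rightarrow> real^2 \<Rightarrow> real^2) \<Rightarrow> (real^2 \<Rightarrow> real) \<Rightarrow> real" where
  "bnd_integral N xi \<Omega> \<Phi> f = (\<Sum>C \<in> bnd_edges N xi \<Omega> \<Phi>. arc_integral C f)"


section \<open>Discrete spaces\<close>

definition S_space :: "nat \<Rightarrow> ('m \<Rightarrow> real^2 \<Rightarrow> real^2) \<Rightarrow> (real^2 \<Rightarrow> real) set" where
  "S_space N \<Phi> =
     {s. \<forall>m. \<exists>g \<in> SK N. \<forall>x \<in> interior refK. s (\<Phi> m x) = (1 / det (jac \<Phi> m x)) * g x}"

definition D_space :: "nat \<Rightarrow> ('m \<Rightarrow> real^2 \<Rightarrow> real^2) \<Rightarrow> (real^2 \<Rightarrow> real^2) set" where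
  "D_space N \<Phi> =
     {q. (\<forall>m. \<exists>u \<in> DK N. \<forall>x \<in> interior refK.
            q (\<Phi> m x) = (1 / det (jac \<Phi> m x)) *\<^sub>R (jac \<Phi> m x *v u x)) \<and>
         (\<forall>m m'. \<forall>a \<in> ref_normals. m \<noteq> m' \<and> \<Phi> m ` ref_side a \<subseteq> elt \<Phi> m' \<longrightarrow>
            (\<forall>x \<in> \<Phi> m ` ref_side a.
               elt_trace \<Phi> m q x \<bullet> elt_normal \<Phi> m a x = elt_trace \<Phi> m' q x \<bullet> elt_normal \<Phi> m a x))}"

text \<open>Elementwise divergence. It is the weak divergence of the fields in the space above, because
  their normal components are continuous across element boundaries.\<close>

definition divg :: "(real^2 \<Rightarrow> real^2) \<Rightarrow> real^2 \<Rightarrow> real" where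
  "divg q x = trace (matrix (frechet_derivative q (at x)))"


section \<open>Degrees of freedom, bases, matrices\<close>

text \<open>The normal component in the space of fields is continuous across element boundaries, so the
  flux does not depend on the element from which the trace is taken.\<close>

definition edge_flux ::
    "('m \<Rightarrow> real^2 \<Rightarrow> real^2) \<Rightarrow> (real^2) set \<Rightarrow> (real^2 \<Rightarrow> real^2) \<Rightarrow> (real^2 \<Rightarrow> real^2) \<Rightarrow> real" where
  "edge_flux \<Phi> C \<nu> q =
     (let m = (SOME m. C \<subseteq> elt \<Phi> m) in arc_integral C (\<lambda>x. elt_trace \<Phi> m q x \<bullet> \<nu> x))"

definition dof1 ::
    "('m \<Rightarrow> real^2 \<Rightarrow> real^2) \<Rightarrow> ('e \<Rightarrow> (real^2) set) \<Rightarrow> ('e \<Rightarrow> real^2 \<Rightarrow> real^2) \<Rightarrow>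
     (real^2 \<Rightarrow> real^2) \<Rightarrow> real^'e" where
  "dof1 \<Phi> edge \<nu> q = (\<chi> e. edge_flux \<Phi> (edge e) (\<nu> e) q)"

definition dof2 :: "('c \<Rightarrow> (real^2) set) \<Rightarrow> (real^2 \<Rightarrow> real) \<Rightarrow> real^'c" where
  "dof2 cell p = (\<chi> c. LINT x:cell c|lebesgue. p x)"

text \<open>\<open>\<Psi>\<close> is a basis of the space \<open>V\<close> of functions on \<open>X\<close>, and the coefficients with respect to
  it are the degrees of freedom \<open>dof\<close>.\<close>

definition dof_basis ::
    "'x set \<Rightarrow> ('x \<Rightarrow> 'v::real_vector) set \<Rightarrow> (('x \<Rightarrow> 'v) \<Rightarrow> real^'i) \<Rightarrow> ('i::finite \<Rightarrow> 'x \<Rightarrow> 'v) \<Rightarrow> bool" where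
  "dof_basis X V dof \<Psi> \<longleftrightarrow>
     (\<forall>i. \<Psi> i \<in> V) \<and>
     (\<forall>c :: real^'i. (\<forall>x \<in> X. (\<Sum>i\<in>UNIV. (c $ i) *\<^sub>R \<Psi> i x) = 0) \<longrightarrow> c = 0) \<and>
     (\<forall>f \<in> V. \<forall>x \<in> X. f x = (\<Sum>i\<in>UNIV. (dof f $ i) *\<^sub>R \<Psi> i x))"

definition incidence_matrix ::
    "nat \<Rightarrow> ('m \<Rightarrow> real^2 \<Rightarrow> real^2) \<Rightarrow> ('e::finite \<Rightarrow> (real^2) set) \<Rightarrow> ('e \<Rightarrow> real^2 \<Rightarrow> real^2) \<Rightarrow>
     ('c::finite \<Rightarrow> real^2 \<Rightarrow> real) \<Rightarrow> real^'e^'c \<Rightarrow> bool" where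
  "incidence_matrix N \<Phi> edge \<nu> \<Psi>2 E \<longleftrightarrow>
     (\<forall>c e. E $ c $ e \<in> {-1, 0, 1}) \<and>
     (\<forall>q \<in> D_space N \<Phi>. \<forall>x \<in> broken \<Phi>.
        divg q x = (\<Sum>c\<in>UNIV. \<Psi>2 c x * (E *v dof1 \<Phi> edge \<nu> q) $ c))"

definition L2_inner :: "(real^2) set \<Rightarrow> (real^2 \<Rightarrow> 'v::real_inner) \<Rightarrow> (real^2 \<Rightarrow> 'v) \<Rightarrow> real" where
  "L2_inner \<Omega> f g = (LINT x:\<Omega>|lebesgue. f x \<bullet> g x)"

definition L2_norm :: "(real^2) set \<Rightarrow> (real^2 \<Rightarrow> 'v::real_inner) \<Rightarrow> real" where
  "L2_norm \<Omega> f = sqrt (L2_inner \<Omega> f f)"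

definition mass_matrix :: "(real^2) set \<Rightarrow> ('i \<Rightarrow> real^2 \<Rightarrow> 'v::real_inner) \<Rightarrow> real^'i^'i" where
  "mass_matrix \<Omega> \<Psi> = (\<chi> i j. L2_inner \<Omega> (\<Psi> i) (\<Psi> j))"

definition dual_basis :: "real^'i^'i \<Rightarrow> ('i::finite \<Rightarrow> 'x \<Rightarrow> 'v::real_vector) \<Rightarrow> 'i \<Rightarrow> 'x \<Rightarrow> 'v" where
  "dual_basis M \<Psi> j x = (\<Sum>i\<in>UNIV. (matrix_inv M $ i $ j) *\<^sub>R \<Psi> i x)"

text \<open>Degrees of freedom with respect to the dual basis of \<open>\<Psi>2\<close>.\<close>

definition dual_dof0 ::
    "(real^2) set \<Rightarrow> ('c::finite \<Rightarrow> (real^2) set) \<Rightarrow> ('c \<Rightarrow> real^2 \<Rightarrow> real) \<Rightarrow> (real^2 \<Rightarrow> real) \<Rightarrow> real^'c" where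
  "dual_dof0 \<Omega> cell \<Psi>2 s = mass_matrix \<Omega> \<Psi>2 *v dof2 cell s"


section \<open>Boundary spaces\<close>

text \<open>\<open>bnd\<close> enumerates the indices of the small edges contained in the boundary.\<close>

definition inclusion_matrix ::
    "('m \<Rightarrow> real^2 \<Rightarrow> real^2) \<Rightarrow> ('e \<Rightarrow> (real^2) set) \<Rightarrow> ('e \<Rightarrow> real^2 \<Rightarrow> real^2) \<Rightarrow> ('b \<Rightarrow> 'e) \<Rightarrow>
     real^'b^'e" where
  "inclusion_matrix \<Phi> edge \<nu> bnd =
     (\<chi> e b. if e = bnd b
              then (if \<forall>x \<in> edge e - vertices \<Phi>. \<nu> e x = outer_normal \<Phi> x then 1 else -1)
              else 0)"

definition bnd_basis ::
    "('m \<Rightarrow> real^2 \<Rightarrow> real^2) \<Rightarrow> ('e::finite \<Rightarrow> (real^2) set) \<Rightarrow> ('e \<Rightarrow> real^2 \<Rightarrow> real^2) \<Rightarrow> ('b::finite \<Rightarrow> 'e) \<Rightarrow>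
     ('e \<Rightarrow> real^2 \<Rightarrow> real^2) \<Rightarrow> 'b \<Rightarrow> real^2 \<Rightarrow> real" where
  "bnd_basis \<Phi> edge \<nu> bnd \<Psi>1 b x =
     (\<Sum>e\<in>UNIV. normal_trace \<Phi> (\<Psi>1 e) x * inclusion_matrix \<Phi> edge \<nu> bnd $ e $ b)"

definition bnd_mass_matrix ::
    "nat \<Rightarrow> (nat \<Rightarrow> real) \<Rightarrow> (real^2) set \<Rightarrow> ('m \<Rightarrow> real^2 \<Rightarrow> real^2) \<Rightarrow> ('b \<Rightarrow> real^2 \<Rightarrow> real) \<Rightarrow> real^'b^'b" where
  "bnd_mass_matrix N xi \<Omega> \<Phi> \<Psi>b = (\<chi> i j. bnd_integral N xi \<Omega> \<Phi> (\<lambda>x. \<Psi>b i x * \<Psi>b j x))"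

text \<open>Span of the dual boundary basis. Normal components have no value at the corners of the
  elements, where functions on the boundary are therefore left undetermined.\<close>

definition dual_bnd_space ::
    "nat \<Rightarrow> (nat \<Rightarrow> real) \<Rightarrow> (real^2) set \<Rightarrow> ('m \<Rightarrow> real^2 \<Rightarrow> real^2) \<Rightarrow> ('e::finite \<Rightarrow> (real^2) set) \<Rightarrow>
     ('e \<Rightarrow> real^2 \<Rightarrow> real^2) \<Rightarrow> ('b::finite \<Rightarrow> 'e) \<Rightarrow> ('e \<Rightarrow> real^2 \<Rightarrow> real^2) \<Rightarrow> (real^2 \<Rightarrow> real) set" where
  "dual_bnd_space N xi \<Omega> \<Phi> edge \<nu> bnd \<Psi>1 =
     (let \<Psi>b = bnd_basis \<Phi> edge \<nu> bnd \<Psi>1; Mb = bnd_mass_matrix N xi \<Omega> \<Phi> \<Psi>b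
      in {s. \<exists>c :: real^'b. \<forall>x \<in> frontier \<Omega> - vertices \<Phi>.
               s x = (\<Sum>b\<in>UNIV. c $ b * dual_basis Mb \<Psi>b b x)})"


section \<open>Dual gradient and norms\<close>

text \<open>The dual spaces on the domain are, as sets of functions, the primal ones, so
  \<open>S_space\<close> and \<open>D_space\<close> are used for both.\<close>

definition dual_grad ::
    "nat \<Rightarrow> (nat \<Rightarrow> real) \<Rightarrow> (real^2) set \<Rightarrow> ('m \<Rightarrow> real^2 \<Rightarrow> real^2) \<Rightarrow>
     (real^2 \<Rightarrow> real) \<Rightarrow> (real^2 \<Rightarrow> real) \<Rightarrow> real^2 \<Rightarrow> real^2" where
  "dual_grad N xi \<Omega> \<Phi> s sb =
     (SOME g. g \<in> D_space N \<Phi> \<and>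
        (\<forall>q \<in> D_space N \<Phi>.
           L2_inner \<Omega> g q =
             - L2_inner \<Omega> s (divg q) + bnd_integral N xi \<Omega> \<Phi> (\<lambda>x. sb x * normal_trace \<Phi> q x)))"

definition Hgrad_norm ::
    "nat \<Rightarrow> (nat \<Rightarrow> real) \<Rightarrow> (real^2) set \<Rightarrow> ('m \<Rightarrow> real^2 \<Rightarrow> real^2) \<Rightarrow>
     (real^2 \<Rightarrow> real) \<Rightarrow> (real^2 \<Rightarrow> real) \<Rightarrow> real" where
  "Hgrad_norm N xi \<Omega> \<Phi> s sb =
     sqrt ((L2_norm \<Omega> s)\<^sup>2 + (L2_norm \<Omega> (dual_grad N xi \<Omega> \<Phi> s sb))\<^sup>2)"

definition dual_bnd_norm ::
    "nat \<Rightarrow> (nat \<Rightarrow> real) \<Rightarrow> (real^2) set \<Rightarrow> ('m \<Rightarrow> real^2 \<Rightarrow> real^2) \<Rightarrow> (real^2 \<Rightarrow> real) \<Rightarrow> real" where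
  "dual_bnd_norm N xi \<Omega> \<Phi> sb = (INF s \<in> S_space N \<Phi>. Hgrad_norm N xi \<Omega> \<Phi> s sb)"

definition Hdiv_norm :: "(real^2) set \<Rightarrow> (real^2 \<Rightarrow> real^2) \<Rightarrow> real" where
  "Hdiv_norm \<Omega> q = sqrt ((L2_norm \<Omega> q)\<^sup>2 + (L2_norm \<Omega> (divg q))\<^sup>2)"

end

(* The Neumann problem says exactly that q is the dual gradient of (div q, phib). Let
   d = phi - div q and e = grad(d, 0); then grad(phi, phib) = e + q, and testing the Dirichlet
   problem with d gives |e|^2 + |d|^2 = 0, hence phi = div q and grad(phi, phib) = q. The norm
   identity follows, and orthogonality (Pythagoras) makes phi the minimiser in the boundary norm.
   The analytic content is that the forms involved are really bilinear: discrete fields are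
   piecewise continuous up to the element boundaries, so they have traces and all integrands are
   bounded and measurable; the dual gradient then exists by the finite-dimensional Riesz theorem. *)

theory Submission
  imports Defs
begin

section \<open>The L2 inner product of bounded continuous functions\<close>

text \<open>Fields are total functions, but membership in \<open>S_space\<close> and
  \<open>D_space\<close> and the equality in the conclusion concern \<open>broken \<Phi>\<close>
  only, \<open>dual_grad\<close> is one chosen representative, and boundary data are free at the
  vertices. So every functional must be shown to depend on values on \<open>broken \<Phi>\<close>
  alone, and uniqueness always means equality there. A second obstacle: \<open>Lim\<close>, the
  Lebesgue integral and choice return some value even when the limit, integrability or the object is
  missing, and additivity may then fail. Traces, integrability and regular parametrisations
  therefore have to be secured before any linear algebra. Linearity of \<open>divg\<close> comes
  from algebra instead of differentiation: the incidence relation expresses the divergence through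
  degrees of freedom, and these are linear because coefficients in a basis are unique. The boundary
  terms are the most delicate, since the side chosen by \<open>bnd_side\<close> may jump from point
  to point.\<close>

text \<open>No measurability is needed: Lebesgue measure is complete, so measurability carries over from
  either function to the other, and the integral of a non-integrable function is 0.\<close>

lemma lebesgue_integral_cong_AE:
  fixes f g :: "'a::euclidean_space \<Rightarrow> real"
  assumes "AE x in lebesgue. f x = g x"
  shows "integral\<^sup>L lebesgue f = integral\<^sup>L lebesgue g"
    and "integrable lebesgue f \<longleftrightarrow> integrable lebesgue g"
proof -
  have "AE x in lebesgue. g x = f x"
    using assms by eventually_elim simp
  then have "f \<in> borel_measurable lebesgue \<longleftrightarrow> g \<in> borel_measurable lebesgue"
    using borel_measurable_AE assms by blast
  then show "integral\<^sup>L lebesgue f = integral\<^sup>L lebesgue g"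
    and "integrable lebesgue f \<longleftrightarrow> integrable lebesgue g"
    using assms integral_cong_AE[of f lebesgue g] integrable_cong_AE[of f lebesgue g]
      not_integrable_integral_eq borel_measurable_integrable by metis+
qed

text \<open>The class of the volume integrands: boundedness gives integrability on bounded sets, and
  continuity on an open set upgrades almost-everywhere vanishing to vanishing.\<close>

definition bcont_on :: "'a::metric_space set \<Rightarrow> ('a \<Rightarrow> 'v::real_normed_vector) \<Rightarrow> bool" where
  "bcont_on B f \<longleftrightarrow> continuous_on B f \<and> bounded (f ` B)"

lemma bcont_on_inner:
  fixes f g :: "'a::metric_space \<Rightarrow> 'v::real_inner"
  assumes "bcont_on B f" "bcont_on B g"
  shows "bcont_on B (\<lambda>x. f x \<bullet> g x)"
proof -
  obtain a b where ab: "\<And>x. x \<in> B \<Longrightarrow> norm (f x) \<le> a" "\<And>x. x \<in> B \<Longrightarrow> norm (g x) \<le> b"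
    using assms by (auto simp: bcont_on_def bounded_iff)
  have "norm (f x \<bullet> g x) \<le> a * b" if "x \<in> B" for x
    using Cauchy_Schwarz_ineq2[of "f x" "g x"] mult_mono[OF ab(1) ab(2), OF that that]
      order_trans[OF norm_ge_zero ab(1)[OF that]] by simp
  then show ?thesis
    using assms by (auto simp: bcont_on_def bounded_iff intro!: continuous_intros)
qed

text \<open>Used with \<open>B = broken \<Phi>\<close>: the inner product on the domain sees only
  the set where discrete functions are determined.\<close>

lemma L2_inner_eq_set_integral:
  assumes "B \<subseteq> \<Omega>" "negligible (\<Omega> - B)"
  shows "L2_inner \<Omega> f g = (LINT x:B|lebesgue. f x \<bullet> g x)"
  unfolding L2_inner_def set_lebesgue_integral_def
proof (rule lebesgue_integral_cong_AE)
  show "AE x in lebesgue. indicat_real \<Omega> x *\<^sub>R (f x \<bullet> g x) = indicat_real B x *\<^sub>R (f x \<bullet> g x)"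
    unfolding eventually_ae_filter_negligible
    using assms by (intro exI[of _ "\<Omega> - B"]) (auto simp: indicator_def)
qed

lemma bcont_on_set_integrable:
  fixes f :: "'a::euclidean_space \<Rightarrow> real"
  assumes "bcont_on B f" "open B" "bounded B"
  shows "set_integrable lebesgue B f"
proof -
  obtain a where a: "\<And>x. x \<in> B \<Longrightarrow> norm (f x) \<le> a"
    using assms by (auto simp: bcont_on_def bounded_iff)
  have B: "B \<in> lmeasurable"
    using assms by (simp add: lmeasurable_open)
  have m: "(\<lambda>x. indicat_real B x *\<^sub>R f x) \<in> borel_measurable lebesgue"
    using borel_measurable_continuous_on_indicator[of B f] assms
    by (auto simp: bcont_on_def intro: measurable_completion)
  show ?thesis
    unfolding set_integrable_def
  proof (rule Bochner_Integration.integrable_bound)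
    show "integrable lebesgue (\<lambda>x. a * indicat_real B x)"
      using B by (auto simp: fmeasurable_def)
    show "AE x in lebesgue. norm (indicat_real B x *\<^sub>R f x) \<le> norm (a * indicat_real B x)"
      using a by (intro AE_I2) (force simp: indicator_def)
  qed (fact m)
qed

lemma L2_inner_cong:
  assumes "B \<subseteq> \<Omega>" "negligible (\<Omega> - B)"
    and "\<And>x. x \<in> B \<Longrightarrow> f x = f' x" "\<And>x. x \<in> B \<Longrightarrow> g x = g' x"
  shows "L2_inner \<Omega> f g = L2_inner \<Omega> f' g'"
  unfolding L2_inner_eq_set_integral[OF assms(1,2)] set_lebesgue_integral_def
  by (intro Bochner_Integration.integral_cong) (auto simp: indicator_def assms)

lemma L2_inner_commute: "L2_inner \<Omega> f g = L2_inner \<Omega> g f"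
  by (simp add: L2_inner_def inner_commute)

lemma L2_inner_add_left:
  assumes "B \<subseteq> \<Omega>" "negligible (\<Omega> - B)" "open B" "bounded B"
    and "bcont_on B f" "bcont_on B g" "bcont_on B h"
  shows "L2_inner \<Omega> (\<lambda>x. a *\<^sub>R f x + g x) h = a * L2_inner \<Omega> f h + L2_inner \<Omega> g h"
proof -
  have "set_integrable lebesgue B (\<lambda>x. f x \<bullet> h x)" "set_integrable lebesgue B (\<lambda>x. g x \<bullet> h x)"
    using assms by (auto intro!: bcont_on_set_integrable bcont_on_inner)
  then show ?thesis
    unfolding L2_inner_eq_set_integral[OF assms(1,2)]
    by (simp add: inner_add_left set_integral_add set_integral_mult_right)
qed

text \<open>True even without integrability, where the integral is 0; hence the square root in
  \<open>L2_norm\<close> can always be squared away.\<close>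

lemma L2_inner_nonneg: "L2_inner \<Omega> f f \<ge> 0"
  unfolding L2_inner_def set_lebesgue_integral_def
  by (intro Bochner_Integration.integral_nonneg) (auto simp: indicator_def)

text \<open>Definiteness is pointwise: the points of the open set \<open>B\<close> where the
  continuous \<open>f\<close> is nonzero form an open set, and a nonempty open set is not
  negligible.\<close>

lemma L2_inner_eq_0D:
  assumes "B \<subseteq> \<Omega>" "negligible (\<Omega> - B)" "open B" "bounded B"
    and f: "bcont_on B f" and "L2_inner \<Omega> f f = 0" and "x \<in> B"
  shows "f x = 0"
proof -
  have "set_integrable lebesgue B (\<lambda>x. f x \<bullet> f x)"
    using assms by (auto intro!: bcont_on_set_integrable bcont_on_inner)
  then have "AE x in lebesgue. indicat_real B x *\<^sub>R (f x \<bullet> f x) = 0"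
    using assms(6) integral_nonneg_eq_0_iff_AE[of lebesgue "\<lambda>x. indicat_real B x *\<^sub>R (f x \<bullet> f x)"]
    unfolding L2_inner_eq_set_integral[OF assms(1,2)] set_integrable_def set_lebesgue_integral_def
    by auto
  then obtain Z where Z: "negligible Z" "{x. indicat_real B x *\<^sub>R (f x \<bullet> f x) \<noteq> 0} \<subseteq> Z"
    unfolding eventually_ae_filter_negligible by blast
  have "open (B \<inter> f -` (- {0}))"
    using f \<open>open B\<close> by (intro continuous_open_preimage) (auto simp: bcont_on_def)
  moreover have "negligible (B \<inter> f -` (- {0}))"
    by (rule negligible_subset[OF Z(1)]) (use Z(2) in \<open>auto simp: indicator_def\<close>)
  ultimately show ?thesis
    using open_not_negligible \<open>x \<in> B\<close> by fastforce
qed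

section \<open>Geometry of the mesh\<close>

text \<open>Each element has its own extension \<open>F\<close>, pulled back to the closed reference
  square; nothing links the extensions of neighbouring elements. Compactness of the square gives
  bounds, and the boundary values of \<open>F\<close> are the one-sided traces.\<close>

definition pw_continuous ::
    "('m \<Rightarrow> real^2 \<Rightarrow> real^2) \<Rightarrow> (real^2 \<Rightarrow> 'v::real_normed_vector) \<Rightarrow> bool" where
  "pw_continuous \<Phi> f \<longleftrightarrow>
     (\<forall>m. \<exists>F. continuous_on refK F \<and> (\<forall>\<xi> \<in> interior refK. f (\<Phi> m \<xi>) = F \<xi>))"

lemma compact_refK: "compact refK"
  by (simp add: refK_def compact_cbox)

lemma interior_refK_subset: "interior refK \<subseteq> refK"
  by (rule interior_subset)

lemma interior_refK: "interior refK = box (-1) 1"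
  by (simp add: refK_def interior_cbox)

lemma closure_interior_refK: "closure (interior refK) = refK"
proof -
  have "box (-1) (1::real^2) \<noteq> {}"
    by (simp add: box_ne_empty) (auto simp: inner_axis Basis_vec_def)
  then show ?thesis
    by (simp add: refK_def interior_cbox closure_box)
qed

lemma negligible_refK_diff_interior: "negligible (refK - interior refK)"
  by (simp add: refK_def interior_cbox negligible_frontier_interval)

locale meshed =
  fixes \<Omega> :: "(real^2) set" and \<Phi> :: "'m::finite \<Rightarrow> real^2 \<Rightarrow> real^2"
  assumes mesh: "mesh \<Omega> \<Phi>"
begin

lemma smooth:
  obtains U V g where "open U" "open V" "refK \<subseteq> U" "homeomorphism U V (\<Phi> m) g"
    "\<And>k. Ck_on k U (\<Phi> m)"
proof -
  have "smooth_diffeo_on refK (\<Phi> m)"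
    using mesh by (simp add: mesh_def)
  then obtain U V g where "open U" "open V" "refK \<subseteq> U" "homeomorphism U V (\<Phi> m) g"
    "\<forall>k. Ck_on k U (\<Phi> m)"
    unfolding smooth_diffeo_on_def by (elim exE conjE)
  then show thesis
    using that by simp
qed

lemma inj_on_refK: "inj_on (\<Phi> m) refK"
proof -
  obtain U V g where "open U" "open V" "refK \<subseteq> U" "homeomorphism U V (\<Phi> m) g"
    using smooth[of m] by metis
  then show ?thesis
    by (metis homeomorphism_apply1 inj_on_inverseI subsetD)
qed

text \<open>The derivative is the full one even at boundary points of the closed square, because the
  element map is smooth on an open neighbourhood of it.\<close>

lemma has_derivative_jac:
  assumes "\<xi> \<in> refK"
  shows "(\<Phi> m has_derivative (*v) (jac \<Phi> m \<xi>)) (at \<xi>)"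
proof -
  obtain U V g where "open U" "open V" "refK \<subseteq> U" "homeomorphism U V (\<Phi> m) g"
    "\<And>k. Ck_on k U (\<Phi> m)"
    using smooth[of m] by metis
  from this(5)[of "Suc 0"] this(3) assms have "\<Phi> m differentiable (at \<xi>)"
    by auto
  then have "(*v) (jac \<Phi> m \<xi>) = frechet_derivative (\<Phi> m) (at \<xi>)"
    by (simp add: jac_def linear_frechet_derivative)
  with \<open>\<Phi> m differentiable (at \<xi>)\<close> show ?thesis
    by (simp add: frechet_derivative_works)
qed

lemma continuous_on_jac: "continuous_on refK (jac \<Phi> m)"
proof -
  obtain U V g where U: "open U" "open V" "refK \<subseteq> U" "homeomorphism U V (\<Phi> m) g"
    "\<And>k. Ck_on k U (\<Phi> m)"
    using smooth[of m] by metis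
  have "continuous_on refK (\<lambda>x. frechet_derivative (\<Phi> m) (at x) v)" for v
    using U(5)[of "Suc 0"] by (intro continuous_on_subset[OF _ U(3)]) auto
  then show ?thesis
    by (auto simp: jac_def matrix_def intro!: continuous_intros)
qed

lemma continuous_on_elt_map: "continuous_on refK (\<Phi> m)"
proof (rule continuous_at_imp_continuous_on, rule ballI)
  fix x assume "x \<in> refK"
  show "isCont (\<Phi> m) x"
    using has_derivative_continuous[OF has_derivative_jac[OF \<open>x \<in> refK\<close>]] .
qed

lemma det_jac: "\<xi> \<in> refK \<Longrightarrow> det (jac \<Phi> m \<xi>) > 0"
  using mesh by (simp add: mesh_def)

lemma compact_elt: "compact (elt \<Phi> m)"
  unfolding elt_def by (rule compact_continuous_image[OF continuous_on_elt_map compact_refK])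

lemma continuous_on_inv_elt_map: "continuous_on (elt \<Phi> m) (inv_into refK (\<Phi> m))"
  unfolding elt_def
  by (rule continuous_on_inv[OF continuous_on_elt_map compact_refK])
     (simp add: inj_on_refK inv_into_f_f)

lemma open_open_elt: "open (open_elt \<Phi> m)"
proof -
  obtain U V g where U: "open U" "open V" "refK \<subseteq> U" "homeomorphism U V (\<Phi> m) g"
    using smooth[of m] by metis
  moreover have "openin (top_of_set U) (interior refK)"
    using U interior_refK_subset by (intro open_subset) auto
  ultimately have "openin (top_of_set V) (\<Phi> m ` interior refK)"
    using homeomorphism_imp_open_map by blast
  then show ?thesis
    using \<open>open V\<close> openin_open_eq by (auto simp: open_elt_def)
qed

lemma open_elt_subset_elt: "open_elt \<Phi> m \<subseteq> elt \<Phi> m"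
  using interior_refK_subset by (auto simp: open_elt_def elt_def)

lemma open_broken: "open (broken \<Phi>)"
  unfolding broken_def by (intro open_UN ballI open_open_elt)

lemma broken_subset: "broken \<Phi> \<subseteq> \<Omega>"
  using mesh by (auto simp: broken_def mesh_def)

lemma bounded_broken: "bounded (broken \<Phi>)"
proof -
  have "bounded (\<Union>m. elt \<Phi> m)"
    by (intro bounded_UN ballI compact_imp_bounded compact_elt) simp
  then show ?thesis
    by (rule bounded_subset) (unfold broken_def, intro UN_mono subset_refl open_elt_subset_elt)
qed

text \<open>The closed elements cover the domain, so only images of the boundary of the reference
  square are missed, and differentiable maps of the plane send null sets to null sets.\<close>

lemma negligible_diff_broken: "negligible (\<Omega> - broken \<Phi>)"
proof -
  have "negligible (\<Phi> m ` (refK - interior refK))" for m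
  proof (rule negligible_differentiable_image_negligible)
    show "\<Phi> m differentiable_on (refK - interior refK)"
      unfolding differentiable_on_def differentiable_def
      by (intro ballI exI, rule has_derivative_at_withinI, rule has_derivative_jac) blast
  qed (auto simp: negligible_refK_diff_interior)
  then have "negligible (\<Union>m. \<Phi> m ` (refK - interior refK))"
    by (intro negligible_Union) auto
  moreover have "\<Omega> \<subseteq> (\<Union>m. elt \<Phi> m)"
    using mesh closure_subset[of \<Omega>] by (simp add: mesh_def)
  then have "\<Omega> - broken \<Phi> \<subseteq> (\<Union>m. \<Phi> m ` (refK - interior refK))"
    by (fastforce simp: broken_def open_elt_def elt_def)
  ultimately show ?thesis
    by (rule negligible_subset)
qed

text \<open>On an open element the function is \<open>F\<close> composed with the inverse element
  map. Continuity on open pieces carries over to their union, and finitely many compact images give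
  a common bound.\<close>

lemma pw_continuous_imp_bcont_on:
  assumes "pw_continuous \<Phi> f"
  shows "bcont_on (broken \<Phi>) f"
proof -
  obtain F where F: "\<And>m. continuous_on refK (F m)" "\<And>m \<xi>. \<xi> \<in> interior refK \<Longrightarrow> f (\<Phi> m \<xi>) = F m \<xi>"
    using assms unfolding pw_continuous_def by metis
  have eq: "f x = F m (inv_into refK (\<Phi> m) x)" if "x \<in> open_elt \<Phi> m" for m x
    using that F(2) inj_on_refK[of m] interior_refK_subset
    by (auto simp: open_elt_def inv_into_f_f subsetD)
  have "continuous_on (open_elt \<Phi> m) (\<lambda>x. F m (inv_into refK (\<Phi> m) x))" for m
  proof (rule continuous_on_compose2[OF F(1)])
    show "continuous_on (open_elt \<Phi> m) (inv_into refK (\<Phi> m))"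
      using continuous_on_inv_elt_map open_elt_subset_elt by (rule continuous_on_subset)
    show "inv_into refK (\<Phi> m) ` open_elt \<Phi> m \<subseteq> refK"
      using open_elt_subset_elt[of m] by (auto simp: elt_def intro!: inv_into_into)
  qed
  then have "continuous_on (open_elt \<Phi> m) f" for m
    using eq by (simp cong: continuous_on_cong)
  then have "continuous_on (broken \<Phi>) f"
    unfolding broken_def by (intro continuous_on_open_UN open_open_elt) auto
  moreover have "bounded (\<Union>m. F m ` refK)"
    by (intro bounded_UN ballI compact_imp_bounded compact_continuous_image F(1) compact_refK) simp
  then have "bounded (f ` broken \<Phi>)"
    by (rule bounded_subset)
       (use F(2) interior_refK_subset in \<open>fastforce simp: broken_def open_elt_def\<close>)
  ultimately show ?thesis
    by (simp add: bcont_on_def)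
qed

text \<open>The second claim is what makes \<open>Lim\<close> in \<open>elt_trace\<close> well
  determined: limits are unique only along a nontrivial filter.\<close>

lemma tendsto_elt_map:
  assumes f: "continuous_on refK F" "\<And>\<xi>. \<xi> \<in> interior refK \<Longrightarrow> f (\<Phi> m \<xi>) = F \<xi>" and "\<xi> \<in> refK"
  shows "(f \<longlongrightarrow> F \<xi>) (at (\<Phi> m \<xi>) within open_elt \<Phi> m)"
    and "at (\<Phi> m \<xi>) within open_elt \<Phi> m \<noteq> bot"
proof -
  let ?g = "inv_into refK (\<Phi> m)"
  have g: "?g (\<Phi> m \<xi>) = \<xi>" if "\<xi> \<in> refK" for \<xi>
    using that inj_on_refK by (simp add: inv_into_f_f)
  have "continuous_on (elt \<Phi> m) (\<lambda>x. F (?g x))"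
    by (rule continuous_on_compose2[OF f(1) continuous_on_inv_elt_map]) (auto simp: elt_def intro!: inv_into_into)
  then have "((\<lambda>x. F (?g x)) \<longlongrightarrow> F (?g (\<Phi> m \<xi>))) (at (\<Phi> m \<xi>) within elt \<Phi> m)"
    using \<open>\<xi> \<in> refK\<close> by (auto simp: continuous_on_def elt_def)
  then have "((\<lambda>x. F (?g x)) \<longlongrightarrow> F \<xi>) (at (\<Phi> m \<xi>) within open_elt \<Phi> m)"
    using g[OF \<open>\<xi> \<in> refK\<close>] tendsto_within_subset[OF _ open_elt_subset_elt] by auto
  moreover have "F (?g x) = f x" if "x \<in> open_elt \<Phi> m" for x
    using that g f(2) interior_refK_subset by (auto simp: open_elt_def subsetD)
  ultimately show "(f \<longlongrightarrow> F \<xi>) (at (\<Phi> m \<xi>) within open_elt \<Phi> m)"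
    by (subst (asm) Lim_cong_within) auto
  have "\<Phi> m ` closure (interior refK) \<subseteq> closure (\<Phi> m ` interior refK)"
    using continuous_on_elt_map[of m] by (intro image_closure_subset) (auto simp: closure_interior_refK closure_subset)
  then have "\<Phi> m \<xi> \<in> closure (open_elt \<Phi> m)"
    using \<open>\<xi> \<in> refK\<close> by (auto simp: closure_interior_refK open_elt_def)
  \<comment> \<open>A point of the closure is a limit point or a member, and members of an open set
    in the plane are limit points of it as well.\<close>
  then have "\<Phi> m \<xi> islimpt open_elt \<Phi> m"
    using open_open_elt[of m] interior_limit_point[of "\<Phi> m \<xi>" "open_elt \<Phi> m"]
    by (auto simp: closure_def interior_open)
  then show "at (\<Phi> m \<xi>) within open_elt \<Phi> m \<noteq> bot"
    by (simp add: trivial_limit_within)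
qed

end

section \<open>Spaces with degrees of freedom\<close>

lemma continuous_on_tensor_poly:
  assumes "f \<in> tensor_poly k l"
  shows "continuous_on A f"
proof -
  obtain c where "f = (\<lambda>x. \<Sum>i\<le>k. \<Sum>j\<le>l. c i j * (x $ 1) ^ i * (x $ 2) ^ j)"
    using assms unfolding tensor_poly_def by blast
  then show ?thesis
    by (auto intro!: continuous_intros)
qed

lemma tensor_poly_add:
  assumes "f \<in> tensor_poly k l" "g \<in> tensor_poly k l"
  shows "(\<lambda>x. a * f x + g x) \<in> tensor_poly k l"
proof -
  obtain c d where "\<forall>x. f x = (\<Sum>i\<le>k. \<Sum>j\<le>l. c i j * (x $ 1) ^ i * (x $ 2) ^ j)"
    "\<forall>x. g x = (\<Sum>i\<le>k. \<Sum>j\<le>l. d i j * (x $ 1) ^ i * (x $ 2) ^ j)"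
    using assms unfolding tensor_poly_def by blast
  then show ?thesis
    unfolding tensor_poly_def
    by (intro CollectI exI[of _ "\<lambda>i j. a * c i j + d i j"])
       (simp add: sum_distrib_left sum.distrib[symmetric] algebra_simps)
qed

lemma SK_add: "f \<in> SK N \<Longrightarrow> g \<in> SK N \<Longrightarrow> (\<lambda>x. a * f x + g x) \<in> SK N"
  by (simp add: SK_def tensor_poly_add)

lemma DK_add: "f \<in> DK N \<Longrightarrow> g \<in> DK N \<Longrightarrow> (\<lambda>x. a *\<^sub>R f x + g x) \<in> DK N"
  by (simp add: DK_def tensor_poly_add)

section \<open>Finite-dimensional function spaces and the Riesz theorem\<close>

text \<open>A single closure property serves for sums, multiples and differences. Zero is absent
  from it and is obtained later from a basis function.\<close>

definition linear_closed :: "('x \<Rightarrow> 'v::real_vector) set \<Rightarrow> bool" where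
  "linear_closed V \<longleftrightarrow> (\<forall>f \<in> V. \<forall>g \<in> V. \<forall>a. (\<lambda>x. a *\<^sub>R f x + g x) \<in> V)"

lemma linear_closedD:
  assumes "linear_closed V" "f \<in> V" "g \<in> V"
  shows "(\<lambda>x. a *\<^sub>R f x + g x) \<in> V"
  using assms(1)[unfolded linear_closed_def, rule_format, OF assms(2,3)] .

lemma linear_closed_sum:
  assumes V: "linear_closed V" and "finite I" "\<And>i. i \<in> I \<Longrightarrow> f i \<in> V" "(\<lambda>_. 0) \<in> V"
  shows "(\<lambda>x. \<Sum>i\<in>I. c i *\<^sub>R f i x) \<in> V"
  using assms(2,3)
proof (induction I rule: finite_induct)
  case (insert i I)
  then show ?case
    using linear_closedD[OF V, of "f i" "\<lambda>x. \<Sum>i\<in>I. c i *\<^sub>R f i x" "c i"] by simp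
qed (simp add: assms(4))

text \<open>The second clause is essential because \<open>V\<close> may hold distinct functions that
  agree on \<open>X\<close>, and basis expansions are valid on \<open>X\<close> only.\<close>

definition linear_functional_on ::
    "'x set \<Rightarrow> ('x \<Rightarrow> 'v::real_vector) set \<Rightarrow> (('x \<Rightarrow> 'v) \<Rightarrow> real) \<Rightarrow> bool" where
  "linear_functional_on X V l \<longleftrightarrow>
     (\<forall>f \<in> V. \<forall>g \<in> V. \<forall>a. l (\<lambda>x. a *\<^sub>R f x + g x) = a * l f + l g) \<and>
     (\<forall>f \<in> V. \<forall>g \<in> V. (\<forall>x \<in> X. f x = g x) \<longrightarrow> l f = l g)"

lemma linear_functional_on_add:
  assumes "linear_functional_on X V l" "f \<in> V" "g \<in> V"
  shows "l (\<lambda>x. a *\<^sub>R f x + g x) = a * l f + l g"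
  using assms(1)[unfolded linear_functional_on_def, THEN conjunct1, rule_format, OF assms(2,3)] .

lemma linear_functional_on_cong:
  assumes "linear_functional_on X V l" "f \<in> V" "g \<in> V" "\<And>x. x \<in> X \<Longrightarrow> f x = g x"
  shows "l f = l g"
  using assms(1)[unfolded linear_functional_on_def, THEN conjunct2, rule_format, OF assms(2,3)]
    assms(4) .

lemma linear_functional_on_sum:
  assumes V: "linear_closed V" and l: "linear_functional_on X V l"
    and "finite I" "\<And>i. i \<in> I \<Longrightarrow> f i \<in> V" "(\<lambda>_. 0) \<in> V"
  shows "l (\<lambda>x. \<Sum>i\<in>I. c i *\<^sub>R f i x) = (\<Sum>i\<in>I. c i * l (f i))"
  using assms(3,4)
proof (induction I rule: finite_induct)
  case empty
  \<comment> \<open>With coefficient 1 and both functions zero, additivity reads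
    \<open>l 0 = l 0 + l 0\<close>.\<close>
  show ?case
    using linear_functional_on_add[OF l \<open>(\<lambda>_. 0) \<in> V\<close> \<open>(\<lambda>_. 0) \<in> V\<close>, of 1] by simp
next
  case (insert i I)
  then have "(\<lambda>x. \<Sum>i\<in>I. c i *\<^sub>R f i x) \<in> V"
    using assms(5) by (intro linear_closed_sum[OF V]) auto
  then have "l (\<lambda>x. c i *\<^sub>R f i x + (\<Sum>i\<in>I. c i *\<^sub>R f i x)) = c i * l (f i) + l (\<lambda>x. \<Sum>i\<in>I. c i *\<^sub>R f i x)"
    using insert.prems by (intro linear_functional_on_add[OF l]) auto
  then show ?case
    using insert by simp
qed

lemma dof_basis_in: "dof_basis X V dof \<Psi> \<Longrightarrow> \<Psi> i \<in> V"
  by (simp add: dof_basis_def)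

lemma dof_basis_expand:
  "dof_basis X V dof \<Psi> \<Longrightarrow> f \<in> V \<Longrightarrow> x \<in> X \<Longrightarrow> f x = (\<Sum>i\<in>UNIV. (dof f $ i) *\<^sub>R \<Psi> i x)"
  by (simp add: dof_basis_def)

lemma dof_basis_zero:
  assumes "dof_basis X V dof \<Psi>" "linear_closed V"
  shows "(\<lambda>_. 0) \<in> V"
proof -
  \<comment> \<open>Index types are nonempty, so this is some element of \<open>V\<close>; minus one
    times it plus itself is zero.\<close>
  have "\<Psi> undefined \<in> V"
    using dof_basis_in[OF assms(1)] .
  from linear_closedD[OF assms(2) this this, of "-1"] show ?thesis
    by simp
qed

lemma dof_basis_unique:
  fixes c :: "real^'i::finite"
  assumes \<Psi>: "dof_basis X V dof \<Psi>" and "\<And>x. x \<in> X \<Longrightarrow> (\<Sum>i\<in>UNIV. c $ i *\<^sub>R \<Psi> i x) = (\<Sum>i\<in>UNIV. d $ i *\<^sub>R \<Psi> i x)"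
  shows "c = d"
proof -
  have "\<forall>x \<in> X. (\<Sum>i\<in>UNIV. (c - d) $ i *\<^sub>R \<Psi> i x) = 0"
    using assms(2) by (simp add: scaleR_diff_left sum_subtractf)
  then have "c - d = 0"
    using \<Psi> unfolding dof_basis_def by blast
  then show ?thesis by simp
qed

text \<open>Linearity of fluxes and cell integrals is not computed from the integrals: degrees of
  freedom are coefficients in a basis, and uniqueness of coefficients forces it.\<close>

lemma dof_basis_add:
  assumes \<Psi>: "dof_basis X V dof \<Psi>" and V: "linear_closed V" and "f \<in> V" "g \<in> V"
  shows "dof (\<lambda>x. a *\<^sub>R f x + g x) = a *\<^sub>R dof f + dof g"
proof (rule dof_basis_unique[OF \<Psi>])
  fix x assume x: "x \<in> X"
  have "(\<Sum>i\<in>UNIV. dof (\<lambda>x. a *\<^sub>R f x + g x) $ i *\<^sub>R \<Psi> i x) = a *\<^sub>R f x + g x"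
    using dof_basis_expand[OF \<Psi> linear_closedD[OF V] x] assms by simp
  also have "\<dots> = (\<Sum>i\<in>UNIV. (a *\<^sub>R dof f + dof g) $ i *\<^sub>R \<Psi> i x)"
    unfolding dof_basis_expand[OF \<Psi> \<open>f \<in> V\<close> x] dof_basis_expand[OF \<Psi> \<open>g \<in> V\<close> x]
    by (simp add: scaleR_add_left sum.distrib scaleR_sum_right)
  finally show "(\<Sum>i\<in>UNIV. dof (\<lambda>x. a *\<^sub>R f x + g x) $ i *\<^sub>R \<Psi> i x) =
    (\<Sum>i\<in>UNIV. (a *\<^sub>R dof f + dof g) $ i *\<^sub>R \<Psi> i x)" .
qed

text \<open>The Gram map from coefficient vectors to pairings with the basis is injective by
  definiteness, hence surjective in finite dimension. Definiteness is asked only up to values off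
  \<open>X\<close>, which suffices since the basis is independent on \<open>X\<close>.\<close>

lemma riesz_dof_basis:
  fixes \<Psi> :: "'i::finite \<Rightarrow> 'x \<Rightarrow> 'v::real_vector"
  assumes \<Psi>: "dof_basis X V dof \<Psi>" and V: "linear_closed V"
    and l: "linear_functional_on X V l"
    and B: "\<And>f. f \<in> V \<Longrightarrow> linear_functional_on X V (\<lambda>g. B g f)"
    and sym: "\<And>f g. B f g = B g f"
    and pos: "\<And>f x. f \<in> V \<Longrightarrow> B f f = 0 \<Longrightarrow> x \<in> X \<Longrightarrow> f x = 0"
  shows "\<exists>g \<in> V. \<forall>f \<in> V. B g f = l f"
proof -
  define u where "u c = (\<lambda>x. \<Sum>i\<in>UNIV. (c $ i) *\<^sub>R \<Psi> i x)" for c :: "real^'i"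
  have z: "(\<lambda>_. 0) \<in> V"
    using dof_basis_zero[OF \<Psi> V] .
  have u: "u c \<in> V" for c
    unfolding u_def using z dof_basis_in[OF \<Psi>] by (intro linear_closed_sum[OF V]) auto
  have expand: "k f = (\<Sum>i\<in>UNIV. dof f $ i * k (\<Psi> i))"
    if "linear_functional_on X V k" "f \<in> V" for k f
  proof -
    have "k f = k (u (dof f))"
      using dof_basis_expand[OF \<Psi> \<open>f \<in> V\<close>]
      by (intro linear_functional_on_cong[OF that u]) (simp add: u_def)
    then show ?thesis
      using linear_functional_on_sum[OF V that(1), of UNIV \<Psi>] z dof_basis_in[OF \<Psi>]
      by (simp add: u_def)
  qed
  have Bu: "B (u c) f = (\<Sum>i\<in>UNIV. c $ i * B (\<Psi> i) f)" if "f \<in> V" for f c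
    unfolding u_def using z dof_basis_in[OF \<Psi>]
    by (intro linear_functional_on_sum[OF V B[OF that]]) auto
  define G where "G c = (\<chi> j. B (u c) (\<Psi> j))" for c
  have "linear G"
    by (rule linearI)
      (simp_all add: G_def vec_eq_iff Bu dof_basis_in[OF \<Psi>] sum.distrib algebra_simps sum_distrib_left)
  moreover have "inj G"
    unfolding linear_injective_0[OF \<open>linear G\<close>]
  proof (intro allI impI)
    fix c assume "G c = 0"
    then have "B (\<Psi> j) (u c) = 0" for j
      using sym[of "\<Psi> j"] by (simp add: G_def vec_eq_iff)
    then have "B (u c) (u c) = 0"
      using Bu[OF u] by simp
    then have "\<forall>x \<in> X. u c x = 0"
      using pos[OF u] by blast
    then show "c = 0"
      using \<Psi> unfolding dof_basis_def u_def by blast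
  qed
  ultimately have "surj G"
    by (rule linear_inj_imp_surj)
  then obtain c where "G c = (\<chi> j. l (\<Psi> j))"
    by (metis surjD)
  then have c: "B (u c) (\<Psi> j) = l (\<Psi> j)" for j
    by (simp add: G_def vec_eq_iff)
  \<comment> \<open>Both sides are linear in \<open>f\<close> and blind to values off
    \<open>X\<close>, so agreement on the basis is enough.\<close>
  have "B (u c) f = l f" if "f \<in> V" for f
    using expand[OF l that] expand[OF B[OF u[of c]] that] sym[of _ "u c"] c by simp
  then show ?thesis
    using u by blast
qed

lemma D_spaceD:
  assumes "q \<in> D_space N \<Phi>"
  shows "\<exists>u\<in>DK N. \<forall>x\<in>interior refK. q (\<Phi> m x) = (1 / det (jac \<Phi> m x)) *\<^sub>R (jac \<Phi> m x *v u x)"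
    and "a \<in> ref_normals \<Longrightarrow> m \<noteq> m' \<Longrightarrow> \<Phi> m ` ref_side a \<subseteq> elt \<Phi> m' \<Longrightarrow> x \<in> \<Phi> m ` ref_side a \<Longrightarrow>
      elt_trace \<Phi> m q x \<bullet> elt_normal \<Phi> m a x = elt_trace \<Phi> m' q x \<bullet> elt_normal \<Phi> m a x"
proof -
  note * = assms[unfolded D_space_def mem_Collect_eq]
  show "\<exists>u\<in>DK N. \<forall>x\<in>interior refK. q (\<Phi> m x) = (1 / det (jac \<Phi> m x)) *\<^sub>R (jac \<Phi> m x *v u x)"
    using *[THEN conjunct1, THEN spec] .
  show "elt_trace \<Phi> m q x \<bullet> elt_normal \<Phi> m a x = elt_trace \<Phi> m' q x \<bullet> elt_normal \<Phi> m a x"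
    if "a \<in> ref_normals" "m \<noteq> m'" "\<Phi> m ` ref_side a \<subseteq> elt \<Phi> m'" "x \<in> \<Phi> m ` ref_side a"
    using *[THEN conjunct2, THEN spec, THEN spec, THEN bspec, OF that(1), THEN mp,
        OF conjI[OF that(2) that(3)], THEN bspec, OF that(4)] .
qed

lemma D_spaceI:
  assumes "\<And>m. \<exists>u\<in>DK N. \<forall>x\<in>interior refK.
      q (\<Phi> m x) = (1 / det (jac \<Phi> m x)) *\<^sub>R (jac \<Phi> m x *v u x)"
    and "\<And>m m' a x. a \<in> ref_normals \<Longrightarrow> m \<noteq> m' \<Longrightarrow> \<Phi> m ` ref_side a \<subseteq> elt \<Phi> m' \<Longrightarrow>
      x \<in> \<Phi> m ` ref_side a \<Longrightarrow>
      elt_trace \<Phi> m q x \<bullet> elt_normal \<Phi> m a x = elt_trace \<Phi> m' q x \<bullet> elt_normal \<Phi> m a x"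
  shows "q \<in> D_space N \<Phi>"
  unfolding D_space_def mem_Collect_eq
proof (intro conjI allI ballI impI)
  show "\<exists>u\<in>DK N. \<forall>x\<in>interior refK. q (\<Phi> m x) = (1 / det (jac \<Phi> m x)) *\<^sub>R (jac \<Phi> m x *v u x)" for m
    by (rule assms(1))
next
  fix m m' a x
  assume "a \<in> ref_normals" "m \<noteq> m' \<and> \<Phi> m ` ref_side a \<subseteq> elt \<Phi> m'" "x \<in> \<Phi> m ` ref_side a"
  then show "elt_trace \<Phi> m q x \<bullet> elt_normal \<Phi> m a x = elt_trace \<Phi> m' q x \<bullet> elt_normal \<Phi> m a x"
    by (elim conjE) (rule assms(2))
qed

section \<open>Discrete fields up to the element boundaries: traces and linear structure\<close>

context meshed
begin

lemma continuous_on_jac_nth: "continuous_on refK (\<lambda>\<xi>. jac \<Phi> m \<xi> $ i $ j)"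
  using bounded_linear.continuous_on[OF bounded_linear_vec_nth
      bounded_linear.continuous_on[OF bounded_linear_vec_nth continuous_on_jac]] .

lemma continuous_on_det_jac: "continuous_on refK (\<lambda>\<xi>. det (jac \<Phi> m \<xi>))"
  unfolding det_2
  by (intro continuous_on_diff continuous_on_mult continuous_on_jac_nth)

lemma continuous_on_inverse_det_jac: "continuous_on refK (\<lambda>\<xi>. 1 / det (jac \<Phi> m \<xi>))"
proof -
  have "\<forall>\<xi>\<in>refK. det (jac \<Phi> m \<xi>) \<noteq> 0"
    by (intro ballI less_imp_neq[symmetric] det_jac)
  then show ?thesis
    by (intro continuous_on_divide continuous_on_det_jac continuous_on_const)
qed

lemma S_space_pw_continuous:
  assumes "s \<in> S_space N \<Phi>"
  shows "pw_continuous \<Phi> s"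
  unfolding pw_continuous_def
proof
  fix m
  obtain g where g: "g \<in> SK N" "\<forall>x \<in> interior refK. s (\<Phi> m x) = (1 / det (jac \<Phi> m x)) * g x"
    using assms unfolding S_space_def by blast
  have "continuous_on refK g"
    using g(1) continuous_on_tensor_poly by (simp add: SK_def)
  then have "continuous_on refK (\<lambda>x. (1 / det (jac \<Phi> m x)) * g x)"
    using continuous_on_inverse_det_jac by (intro continuous_on_mult)
  with g(2) show "\<exists>F. continuous_on refK F \<and> (\<forall>\<xi> \<in> interior refK. s (\<Phi> m \<xi>) = F \<xi>)"
    by blast
qed

text \<open>The Piola transform of a polynomial field extends continuously to the closed square,
  where the Jacobian is continuous and its determinant has no zero.\<close>

lemma D_space_pw_continuous:
  assumes "q \<in> D_space N \<Phi>"
  shows "pw_continuous \<Phi> q"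
  unfolding pw_continuous_def
proof
  fix m
  obtain u where u: "u \<in> DK N"
    "\<forall>x \<in> interior refK. q (\<Phi> m x) = (1 / det (jac \<Phi> m x)) *\<^sub>R (jac \<Phi> m x *v u x)"
    using assms unfolding D_space_def by blast
  have "continuous_on refK (\<lambda>x. u x $ 1)" "continuous_on refK (\<lambda>x. u x $ 2)"
    using u(1) continuous_on_tensor_poly by (auto simp: DK_def)
  then have "continuous_on refK (\<lambda>x. jac \<Phi> m x $ i $ 1 * u x $ 1 + jac \<Phi> m x $ i $ 2 * u x $ 2)"
    for i
    by (intro continuous_on_add continuous_on_mult continuous_on_jac_nth)
  then have "continuous_on refK (\<lambda>x. jac \<Phi> m x *v u x)"
    unfolding matrix_vector_mult_def sum_2 by (rule continuous_on_vec_lambda)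
  then have "continuous_on refK (\<lambda>x. (1 / det (jac \<Phi> m x)) *\<^sub>R (jac \<Phi> m x *v u x))"
    using continuous_on_inverse_det_jac by (intro continuous_on_scaleR)
  with u(2) show "\<exists>F. continuous_on refK F \<and> (\<forall>\<xi> \<in> interior refK. q (\<Phi> m \<xi>) = F \<xi>)"
    by blast
qed

text \<open>Replaces the limit by evaluation of the continuous extension; additivity, congruence and
  continuity of traces all reduce to it.\<close>

lemma elt_trace_eq:
  assumes "continuous_on refK F" "\<And>\<xi>. \<xi> \<in> interior refK \<Longrightarrow> f (\<Phi> m \<xi>) = F \<xi>" and "x \<in> elt \<Phi> m"
  shows "elt_trace \<Phi> m f x = F (inv_into refK (\<Phi> m) x)"
proof -
  obtain \<xi> where \<xi>: "\<xi> \<in> refK" "x = \<Phi> m \<xi>"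
    using \<open>x \<in> elt \<Phi> m\<close> by (auto simp: elt_def)
  then have "Lim (at x within open_elt \<Phi> m) f = F \<xi>"
    using tendsto_elt_map[OF assms(1,2), of \<xi>] by (intro tendsto_Lim) auto
  then show ?thesis
    using \<xi> inj_on_refK by (simp add: elt_trace_def inv_into_f_f)
qed

lemma elt_trace_add:
  assumes "pw_continuous \<Phi> p" "pw_continuous \<Phi> q" "x \<in> elt \<Phi> m"
  shows "elt_trace \<Phi> m (\<lambda>x. a *\<^sub>R p x + q x) x = a *\<^sub>R elt_trace \<Phi> m p x + elt_trace \<Phi> m q x"
proof -
  obtain F G where F: "continuous_on refK F" "\<And>\<xi>. \<xi> \<in> interior refK \<Longrightarrow> p (\<Phi> m \<xi>) = F \<xi>"
    and G: "continuous_on refK G" "\<And>\<xi>. \<xi> \<in> interior refK \<Longrightarrow> q (\<Phi> m \<xi>) = G \<xi>"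
    using assms unfolding pw_continuous_def by metis
  have "elt_trace \<Phi> m (\<lambda>x. a *\<^sub>R p x + q x) x =
      (\<lambda>\<xi>. a *\<^sub>R F \<xi> + G \<xi>) (inv_into refK (\<Phi> m) x)"
  proof (rule elt_trace_eq)
    show "continuous_on refK (\<lambda>\<xi>. a *\<^sub>R F \<xi> + G \<xi>)"
      by (intro continuous_on_add continuous_on_scaleR continuous_on_const F(1) G(1))
  qed (simp_all add: F(2) G(2) assms(3))
  then show ?thesis
    using elt_trace_eq[of F p, OF F \<open>x \<in> elt \<Phi> m\<close>] elt_trace_eq[of G q, OF G \<open>x \<in> elt \<Phi> m\<close>] by simp
qed

lemma elt_trace_cong:
  assumes "pw_continuous \<Phi> p" "\<And>x. x \<in> broken \<Phi> \<Longrightarrow> p x = q x" "x \<in> elt \<Phi> m"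
  shows "elt_trace \<Phi> m p x = elt_trace \<Phi> m q x"
proof -
  obtain F where F: "continuous_on refK F" "\<And>\<xi>. \<xi> \<in> interior refK \<Longrightarrow> p (\<Phi> m \<xi>) = F \<xi>"
    using assms unfolding pw_continuous_def by metis
  have "\<Phi> m \<xi> \<in> broken \<Phi>" if "\<xi> \<in> interior refK" for \<xi>
    using that by (auto simp: broken_def open_elt_def)
  then have "q (\<Phi> m \<xi>) = F \<xi>" if "\<xi> \<in> interior refK" for \<xi>
    using that F(2) assms(2) by metis
  then show ?thesis
    using elt_trace_eq[of F p, OF F \<open>x \<in> elt \<Phi> m\<close>] elt_trace_eq[of F q, OF F(1) _ \<open>x \<in> elt \<Phi> m\<close>] by simp
qed

lemma continuous_on_elt_trace:
  assumes "pw_continuous \<Phi> q"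
  shows "continuous_on (elt \<Phi> m) (elt_trace \<Phi> m q)"
proof -
  obtain F where F: "continuous_on refK F" "\<And>\<xi>. \<xi> \<in> interior refK \<Longrightarrow> q (\<Phi> m \<xi>) = F \<xi>"
    using assms unfolding pw_continuous_def by metis
  have "continuous_on (elt \<Phi> m) (\<lambda>x. F (inv_into refK (\<Phi> m) x))"
    by (rule continuous_on_compose2[OF F(1) continuous_on_inv_elt_map]) (auto simp: elt_def intro!: inv_into_into)
  then show ?thesis
    using elt_trace_eq[of F q, OF F] by (simp cong: continuous_on_cong)
qed

lemma S_space_linear_closed: "linear_closed (S_space N \<Phi>)"
  unfolding linear_closed_def
proof (intro ballI allI)
  fix s t a assume st: "s \<in> S_space N \<Phi>" "t \<in> S_space N \<Phi>"
  have "\<exists>g\<in>SK N. \<forall>x\<in>interior refK. a *\<^sub>R s (\<Phi> m x) + t (\<Phi> m x) = 1 / det (jac \<Phi> m x) * g x" for m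
  proof -
    obtain f g where f: "f \<in> SK N" "\<forall>x \<in> interior refK. s (\<Phi> m x) = 1 / det (jac \<Phi> m x) * f x"
      and g: "g \<in> SK N" "\<forall>x \<in> interior refK. t (\<Phi> m x) = 1 / det (jac \<Phi> m x) * g x"
      using st[unfolded S_space_def mem_Collect_eq, THEN spec, of m] by (elim bexE)
    show ?thesis
      using f(2) g(2)
      by (intro bexI[OF _ SK_add[OF f(1) g(1), of a]]) (simp add: distrib_left add_divide_distrib)
  qed
  then show "(\<lambda>x. a *\<^sub>R s x + t x) \<in> S_space N \<Phi>"
    unfolding S_space_def mem_Collect_eq by (rule allI)
qed

text \<open>Needed for \<open>divg q\<close>, which is controlled on \<open>broken \<Phi>\<close>
  and nowhere else.\<close>

lemma S_space_cong:
  assumes "s \<in> S_space N \<Phi>" "\<And>x. x \<in> broken \<Phi> \<Longrightarrow> t x = s x"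
  shows "t \<in> S_space N \<Phi>"
proof -
  have "\<Phi> m \<xi> \<in> broken \<Phi>" if "\<xi> \<in> interior refK" for \<xi> m
    using that by (auto simp: broken_def open_elt_def)
  then show ?thesis
    using assms by (auto simp: S_space_def)
qed

text \<open>The interface condition is linear only where the limits behind \<open>elt_trace\<close>
  exist, so piecewise continuity of both fields is established first.\<close>

lemma D_space_linear_closed: "linear_closed (D_space N \<Phi>)"
  unfolding linear_closed_def
proof (intro ballI allI)
  fix p q a assume pq: "p \<in> D_space N \<Phi>" "q \<in> D_space N \<Phi>"
  have pw: "pw_continuous \<Phi> p" "pw_continuous \<Phi> q"
    using pq[THEN D_space_pw_continuous] .
  show "(\<lambda>x. a *\<^sub>R p x + q x) \<in> D_space N \<Phi>"
  proof (rule D_spaceI)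
    fix m
    obtain u v where
      u: "u \<in> DK N" "\<forall>x \<in> interior refK. p (\<Phi> m x) = (1 / det (jac \<Phi> m x)) *\<^sub>R (jac \<Phi> m x *v u x)" and
      v: "v \<in> DK N" "\<forall>x \<in> interior refK. q (\<Phi> m x) = (1 / det (jac \<Phi> m x)) *\<^sub>R (jac \<Phi> m x *v v x)"
      using D_spaceD(1)[OF pq(1), of m] D_spaceD(1)[OF pq(2), of m] by (elim bexE)
    show "\<exists>u\<in>DK N. \<forall>x\<in>interior refK. a *\<^sub>R p (\<Phi> m x) + q (\<Phi> m x) =
        (1 / det (jac \<Phi> m x)) *\<^sub>R (jac \<Phi> m x *v u x)"
      using u(2) v(2)
      by (intro bexI[OF _ DK_add[OF u(1) v(1), of a]])
         (simp add: matrix_vector_right_distrib matrix_vector_mult_scaleR scaleR_add_right mult.commute)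
  next
    fix m m' b x
    assume *: "b \<in> ref_normals" "m \<noteq> m'" "\<Phi> m ` ref_side b \<subseteq> elt \<Phi> m'" "x \<in> \<Phi> m ` ref_side b"
    then have x: "x \<in> elt \<Phi> m" "x \<in> elt \<Phi> m'"
      by (auto simp: ref_side_def elt_def)
    show "elt_trace \<Phi> m (\<lambda>x. a *\<^sub>R p x + q x) x \<bullet> elt_normal \<Phi> m b x =
      elt_trace \<Phi> m' (\<lambda>x. a *\<^sub>R p x + q x) x \<bullet> elt_normal \<Phi> m b x"
      unfolding elt_trace_add[OF pw x(1)] elt_trace_add[OF pw x(2)]
      using D_spaceD(2)[OF pq(1) *] D_spaceD(2)[OF pq(2) *] by (simp add: inner_add_left)
  qed
qed

lemma L2_linear_functional:
  assumes "f \<in> V" "\<And>f. f \<in> V \<Longrightarrow> pw_continuous \<Phi> f"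
  shows "linear_functional_on (broken \<Phi>) V (\<lambda>g. L2_inner \<Omega> g f)"
  unfolding linear_functional_on_def
proof (intro conjI ballI allI impI)
  fix g h a assume "g \<in> V" "h \<in> V"
  then show "L2_inner \<Omega> (\<lambda>x. a *\<^sub>R g x + h x) f = a * L2_inner \<Omega> g f + L2_inner \<Omega> h f"
    using assms(1)
    by (intro L2_inner_add_left[OF broken_subset negligible_diff_broken open_broken bounded_broken]
        pw_continuous_imp_bcont_on assms(2))
next
  fix g h assume "g \<in> V" "h \<in> V" "\<forall>x\<in>broken \<Phi>. g x = h x"
  then show "L2_inner \<Omega> g f = L2_inner \<Omega> h f"
    by (intro L2_inner_cong[OF broken_subset negligible_diff_broken]) simp_all
qed

end

section \<open>Boundary integrals and normal traces\<close>

text \<open>Boundary data are arbitrary off \<open>X\<close>, so the class asks for a global Borel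
  representative. Borel, and not merely Lebesgue, measurability survives composition with a
  parametrisation of an arc.\<close>

definition bounded_borel_on :: "'a::topological_space set \<Rightarrow> ('a \<Rightarrow> real) \<Rightarrow> bool" where
  "bounded_borel_on X f \<longleftrightarrow>
     (\<exists>h \<in> borel_measurable borel. bounded (range h) \<and> (\<forall>x \<in> X. f x = h x))"

lemma bounded_borel_on_mult:
  assumes "bounded_borel_on X f" "bounded_borel_on X g"
  shows "bounded_borel_on X (\<lambda>x. f x * g x)"
proof -
  obtain h k where h: "h \<in> borel_measurable borel" "bounded (range h)" "\<forall>x \<in> X. f x = h x"
    and k: "k \<in> borel_measurable borel" "bounded (range k)" "\<forall>x \<in> X. g x = k x"
    using assms unfolding bounded_borel_on_def by (elim bexE conjE)
  obtain a b where a: "\<And>x. norm (h x) \<le> a" and b: "\<And>x. norm (k x) \<le> b"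
    using h(2) k(2) unfolding bounded_iff by auto
  have "bounded (range (\<lambda>x. h x * k x))"
    unfolding bounded_iff
  proof (intro exI ballI)
    fix y assume "y \<in> range (\<lambda>x. h x * k x)"
    then obtain x where "y = h x * k x" by auto
    then show "norm y \<le> a * b"
      using norm_mult_ineq[of "h x" "k x"] mult_mono[OF a[of x] b[of x]]
        order_trans[OF norm_ge_zero a[of x]] by simp
  qed
  moreover have "(\<lambda>x. h x * k x) \<in> borel_measurable borel"
    using h(1) k(1) by (rule borel_measurable_times)
  ultimately show ?thesis
    unfolding bounded_borel_on_def using h(3) k(3) by (intro bexI[of _ "\<lambda>x. h x * k x"] conjI) simp_all
qed

lemma bounded_borel_on_add:
  assumes "bounded_borel_on X f" "bounded_borel_on X g"
  shows "bounded_borel_on X (\<lambda>x. f x + g x)"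
proof -
  obtain h k where h: "h \<in> borel_measurable borel" "bounded (range h)" "\<forall>x \<in> X. f x = h x"
    and k: "k \<in> borel_measurable borel" "bounded (range k)" "\<forall>x \<in> X. g x = k x"
    using assms unfolding bounded_borel_on_def by (elim bexE conjE)
  have "bounded (range (\<lambda>x. h x + k x))"
    using h(2) k(2) by (rule bounded_plus_comp)
  moreover have "(\<lambda>x. h x + k x) \<in> borel_measurable borel"
    using h(1) k(1) by (rule borel_measurable_add)
  ultimately show ?thesis
    unfolding bounded_borel_on_def using h(3) k(3) by (intro bexI[of _ "\<lambda>x. h x + k x"] conjI) simp_all
qed

lemma bounded_borel_on_const: "bounded_borel_on X (\<lambda>_. c)"
  unfolding bounded_borel_on_def by (intro bexI[of _ "\<lambda>_. c"] conjI ballI)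
    (simp_all add: image_constant_conv)

lemma bounded_borel_on_sum:
  assumes "\<And>i. i \<in> I \<Longrightarrow> bounded_borel_on X (f i)"
  shows "bounded_borel_on X (\<lambda>x. \<Sum>i\<in>I. f i x)"
  using assms
proof (induction I rule: infinite_finite_induct)
  case (insert i I)
  then have "bounded_borel_on X (\<lambda>x. f i x + (\<Sum>i\<in>I. f i x))"
    by (intro bounded_borel_on_add) simp_all
  then show ?case
    using insert.hyps by simp
qed (simp_all add: bounded_borel_on_const)

lemma bounded_borel_on_cong:
  assumes "bounded_borel_on X f" "\<And>x. x \<in> X \<Longrightarrow> g x = f x"
  shows "bounded_borel_on X g"
  using assms unfolding bounded_borel_on_def by simp

section \<open>Integrals over regular arcs\<close>

text \<open>A parametrisation is injective, so finitely many exceptional points on the arc (the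
  element vertices in the application) have finitely many, hence negligible, parameters.\<close>

lemma AE_regular_param:
  fixes f h :: "real^2 \<Rightarrow> real" and v :: "real \<Rightarrow> real"
  assumes "regular_param g C" "finite Z" "\<And>x. x \<in> C - Z \<Longrightarrow> f x = h x"
  shows "AE t in lebesgue. indicat_real {0..1} t *\<^sub>R (f (g t) * v t) =
    indicat_real {0..1} t *\<^sub>R (h (g t) * v t)"
proof -
  have inj: "inj_on g {0..1}" and C: "g ` {0..1} = C"
    using assms(1) by (simp_all add: regular_param_def)
  have "finite (g -` Z \<inter> {0..1})"
    using finite_vimage_IntI[OF assms(2) inj] .
  moreover have "f (g t) = h (g t)" if "t \<in> {0..1}" "t \<notin> g -` Z \<inter> {0..1}" for t
    using that C by (intro assms(3)) auto
  then have "{t. indicat_real {0..1} t *\<^sub>R (f (g t) * v t) \<noteq> indicat_real {0..1} t *\<^sub>R (h (g t) * v t)}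
      \<subseteq> g -` Z \<inter> {0..1}"
    by (auto simp: indicator_def split: if_splits)
  ultimately show ?thesis
    unfolding eventually_ae_filter_negligible using negligible_finite by blast
qed

lemma regular_param_some:
  assumes "\<exists>g. regular_param g C"
  shows "regular_param (SOME g. regular_param g C) C"
  using assms by (rule someI_ex)

lemma arc_integral_cong:
  assumes "\<exists>g. regular_param g C" "finite Z" "\<And>x. x \<in> C - Z \<Longrightarrow> f x = h x"
  shows "arc_integral C f = arc_integral C h"
  unfolding arc_integral_def set_lebesgue_integral_def Let_def
  by (rule lebesgue_integral_cong_AE(1)[OF AE_regular_param[OF regular_param_some[OF assms(1)] assms(2,3)]])

lemma regular_param_integrable:
  assumes g: "regular_param g C" and Z: "finite Z" and f: "bounded_borel_on (C - Z) f"
  shows "set_integrable lebesgue {0..1} (\<lambda>t. f (g t) * norm (vector_derivative g (at t within {0..1})))"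
proof -
  define v where "v t = norm (vector_derivative g (at t within {0..1}))" for t
  obtain h where h: "h \<in> borel_measurable borel" "bounded (range h)" "\<forall>x \<in> C - Z. f x = h x"
    using f unfolding bounded_borel_on_def by (elim bexE conjE)
  have cv: "continuous_on {0..1} v"
    unfolding v_def using g by (intro continuous_on_norm) (simp add: regular_param_def)
  have cg: "continuous_on {0..1} g"
    using g by (simp add: regular_param_def differentiable_imp_continuous_on differentiable_on_def)
  obtain a where a: "\<And>x. norm (h x) \<le> a"
    using h(2) unfolding bounded_iff by auto
  obtain b where b: "\<And>t. t \<in> {0..1} \<Longrightarrow> norm (v t) \<le> b"
    using compact_imp_bounded[OF compact_continuous_image[OF cv]] unfolding bounded_iff by fastforce
  \<comment> \<open>\<open>g\<close> is continuous on the unit interval only; extending it by zero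
    gives a Borel function on the whole line.\<close>
  have mg: "(\<lambda>t. indicat_real {0..1} t *\<^sub>R g t) \<in> borel_measurable borel"
    by (rule borel_measurable_continuous_on_indicator[OF _ cg]) simp
  have mv: "(\<lambda>t. indicat_real {0..1} t *\<^sub>R v t) \<in> borel_measurable borel"
    by (rule borel_measurable_continuous_on_indicator[OF _ cv]) simp
  have "(\<lambda>t. h (indicat_real {0..1} t *\<^sub>R g t) * (indicat_real {0..1} t *\<^sub>R v t)) \<in> borel_measurable borel"
    by (intro borel_measurable_times mv measurable_compose[OF mg h(1)])
  \<comment> \<open>Off the unit interval \<open>h\<close> is evaluated at the origin, but the
    second factor vanishes there.\<close>
  moreover have "(\<lambda>t. h (indicat_real {0..1} t *\<^sub>R g t) * (indicat_real {0..1} t *\<^sub>R v t)) =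
      (\<lambda>t. indicat_real {0..1} t *\<^sub>R (h (g t) * v t))"
    by (auto simp: indicator_def)
  ultimately have m: "(\<lambda>t. indicat_real {0..1} t *\<^sub>R (h (g t) * v t)) \<in> borel_measurable lebesgue"
    by (simp add: measurable_completion)
  have int: "integrable lebesgue (\<lambda>t. indicat_real {0..1} t *\<^sub>R (h (g t) * v t))"
  proof (rule Bochner_Integration.integrable_bound[OF _ m])
    show "integrable lebesgue (\<lambda>t. (a * b) * indicat_real {0..1::real} t)"
      by (intro integrable_mult_right integrable_real_indicator) auto
    show "AE t in lebesgue. norm (indicat_real {0..1} t *\<^sub>R (h (g t) * v t)) \<le>
        norm ((a * b) * indicat_real {0..1::real} t)"
    proof (intro AE_I2)
      fix t :: real
      have "norm (h (g t) * v t) \<le> a * b" if "t \<in> {0..1}"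
        using norm_mult_ineq[of "h (g t)" "v t"] mult_mono[OF a[of "g t"] b[OF that]]
          order_trans[OF norm_ge_zero a[of "g t"]] by simp
      then show "norm (indicat_real {0..1} t *\<^sub>R (h (g t) * v t)) \<le>
        norm ((a * b) * indicat_real {0..1::real} t)"
        by (cases "t \<in> {0..1}") (force simp: indicator_def)+
    qed
  qed
  have ae: "AE t in lebesgue. indicat_real {0..1} t *\<^sub>R (f (g t) * v t) =
      indicat_real {0..1} t *\<^sub>R (h (g t) * v t)"
    by (rule AE_regular_param[OF g Z]) (rule bspec[OF h(3)])
  show ?thesis
    unfolding set_integrable_def v_def[symmetric] lebesgue_integral_cong_AE(2)[OF ae] by (rule int)
qed

lemma arc_integral_add:
  assumes "\<exists>g. regular_param g C" "finite Z" "bounded_borel_on (C - Z) f" "bounded_borel_on (C - Z) h"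
  shows "arc_integral C (\<lambda>x. a * f x + h x) = a * arc_integral C f + arc_integral C h"
proof -
  define g where "g = (SOME g. regular_param g C)"
  have g: "regular_param g C"
    unfolding g_def by (rule regular_param_some[OF assms(1)])
  let ?v = "\<lambda>t. norm (vector_derivative g (at t within {0..1}))"
  have "(LINT t:{0..1}|lebesgue. (a * f (g t) + h (g t)) * ?v t) =
      (LINT t:{0..1}|lebesgue. a * (f (g t) * ?v t) + h (g t) * ?v t)"
    by (simp add: distrib_right mult.assoc)
  also have "\<dots> = (LINT t:{0..1}|lebesgue. a * (f (g t) * ?v t)) + (LINT t:{0..1}|lebesgue. h (g t) * ?v t)"
    by (intro set_integral_add set_integrable_mult_right regular_param_integrable[OF g assms(2)] assms(3,4))
  also have "\<dots> = a * (LINT t:{0..1}|lebesgue. f (g t) * ?v t) + (LINT t:{0..1}|lebesgue. h (g t) * ?v t)"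
    by (simp add: set_integral_mult_right)
  finally show ?thesis
    by (simp add: arc_integral_def g_def[symmetric] Let_def)
qed

section \<open>Inverses of Jacobian matrices\<close>

text \<open>\<open>matrix_inv\<close> is a choice; identifying it with the adjugate formula makes
  its entries visibly continuous in those of the matrix.\<close>

lemma matrix_inv_2:
  fixes A :: "real^2^2"
  defines "B \<equiv> (1 / det A) *\<^sub>R
    (\<chi> i j. if i = 1 then (if j = 1 then A $ 2 $ 2 else - (A $ 1 $ 2))
            else (if j = 1 then - (A $ 2 $ 1) else A $ 1 $ 1))"
  assumes "det A \<noteq> 0"
  shows "matrix_inv A = B" and "matrix_inv A ** A = mat 1"
proof -
  have B: "A ** B = mat 1" "B ** A = mat 1"
    using \<open>det A \<noteq> 0\<close> unfolding B_def
    by (simp_all add: matrix_matrix_mult_def vec_eq_iff forall_2 sum_2 mat_def det_2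
        diff_divide_distrib[symmetric] mult.commute)
  show inv: "matrix_inv A = B"
    unfolding matrix_inv_def
  proof (rule some_equality)
    fix C assume "A ** C = mat 1 \<and> C ** A = mat 1"
    then have "C ** (A ** B) = B"
      by (simp add: matrix_mul_assoc)
    then show "C = B"
      using B(1) by simp
  qed (use B in simp)
  show "matrix_inv A ** A = mat 1"
    using B(2) by (simp add: inv)
qed

text \<open>Keeps the argument of \<open>sgn\<close> in \<open>elt_normal\<close> away from zero,
  where \<open>sgn\<close> is discontinuous. The transpose of \<open>A\<close> is a left inverse of
  the matrix applied to \<open>a\<close>.\<close>

lemma matrix_inv_transpose_mult_nonzero:
  fixes A :: "real^2^2"
  assumes "det A \<noteq> 0" "a \<noteq> 0"
  shows "transpose (matrix_inv A) *v a \<noteq> 0"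
proof
  assume "transpose (matrix_inv A) *v a = 0"
  then have "(transpose A ** transpose (matrix_inv A)) *v a = 0"
    by (simp add: matrix_vector_mul_assoc[symmetric])
  moreover have "matrix_inv A ** A = mat 1"
    using matrix_inv_2(2)[OF assms(1)] .
  ultimately show False
    using assms(2) by (simp add: matrix_transpose_mul[symmetric])
qed

lemma continuous_on_matrix_inv_2:
  fixes A :: "'a::topological_space \<Rightarrow> real^2^2"
  assumes "\<And>i j. continuous_on X (\<lambda>x. A x $ i $ j)" "\<And>x. x \<in> X \<Longrightarrow> det (A x) \<noteq> 0"
  shows "continuous_on X (\<lambda>x. matrix_inv (A x) $ i $ j)"
proof -
  have "continuous_on X (\<lambda>x. det (A x))"
    unfolding det_2 by (intro continuous_on_diff continuous_on_mult assms(1))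
  then have d: "continuous_on X (\<lambda>x. 1 / det (A x))"
    using assms(2) by (intro continuous_on_divide continuous_on_const) auto
  have "continuous_on X (\<lambda>x. (1 / det (A x)) *
    (if i = 1 then (if j = 1 then A x $ 2 $ 2 else - (A x $ 1 $ 2))
            else (if j = 1 then - (A x $ 2 $ 1) else A x $ 1 $ 1)))"
    by (cases "i = 1"; cases "j = 1"; simp only: if_True if_False refl;
        intro continuous_on_mult[OF d] continuous_on_minus assms(1))
  then show ?thesis
    by (rule continuous_on_eq) (simp add: matrix_inv_2(1) assms(2))
qed

section \<open>Sides, vertices and grid edges of the reference square\<close>

lemma finite_ref_vertices: "finite ref_vertices"
proof (rule finite_subset)
  show "ref_vertices \<subseteq> (\<lambda>(a, b). vector [a, b]) ` ({-1, 1} \<times> {-1, 1})"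
  proof
    fix v assume "v \<in> ref_vertices"
    then have "(v $ 1, v $ 2) \<in> {-1, 1} \<times> {-1, 1}"
      unfolding ref_vertices_def by auto
    moreover have "v = vector [v $ 1, v $ 2]"
      by (simp add: vec_eq_iff forall_2)
    ultimately show "v \<in> (\<lambda>(a, b). vector [a, b]) ` ({-1, 1} \<times> {-1, 1})"
      by (metis (no_types, lifting) case_prod_conv image_eqI)
  qed
qed simp

lemma finite_vertices: "finite (vertices (\<Phi> :: 'm::finite \<Rightarrow> _))"
  by (simp add: vertices_def finite_ref_vertices)

lemma finite_ref_normals: "finite ref_normals"
  by (simp add: ref_normals_def)

lemma ref_normals_nonzero: "a \<in> ref_normals \<Longrightarrow> a \<noteq> 0"
  by (auto simp: ref_normals_def nonzero_Basis)

lemma closed_ref_side: "closed (ref_side a)"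
proof -
  have "ref_side a = refK \<inter> {x. a \<bullet> x = 1}"
    by (auto simp: ref_side_def inner_commute)
  then show ?thesis
    by (simp add: closed_Int compact_imp_closed compact_refK closed_hyperplane)
qed

lemma ref_side_cover:
  assumes "\<xi> \<in> refK" "\<xi> \<notin> interior refK"
  shows "\<exists>a \<in> ref_normals. \<xi> \<in> ref_side a"
proof -
  have 1: "(1::real^2) \<bullet> i = 1" if "i \<in> Basis" for i
    using that by (auto simp: Basis_vec_def inner_axis)
  obtain i where i: "i \<in> Basis" "\<not> (-1 < \<xi> \<bullet> i \<and> \<xi> \<bullet> i < 1)"
    using assms(2) unfolding interior_refK mem_box by (auto simp: 1)
  moreover have "-1 \<le> \<xi> \<bullet> i" "\<xi> \<bullet> i \<le> 1"
    using assms(1) i(1) unfolding refK_def mem_box by (auto simp: 1)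
  ultimately consider "\<xi> \<bullet> i = 1" | "\<xi> \<bullet> (- i) = 1"
    by fastforce
  then show ?thesis
  proof cases
    case 1
    then show ?thesis
      using assms(1) i(1) by (intro bexI[of _ i]) (simp_all add: ref_side_def ref_normals_def)
  next
    case 2
    then show ?thesis
      using assms(1) i(1) by (intro bexI[of _ "- i"]) (simp_all add: ref_side_def ref_normals_def)
  qed
qed

lemma gll_nodes_bounds:
  assumes "gll_nodes N xi" "i \<le> N"
  shows "-1 \<le> xi i" "xi i \<le> 1"
proof -
  have m: "strict_mono_on {..N} xi" "xi 0 = -1" "xi N = 1"
    using assms(1) by (simp_all add: gll_nodes_def)
  show "-1 \<le> xi i"
    using strict_mono_on_leD[OF m(1), of 0 i] m(2) assms(2) by simp
  show "xi i \<le> 1"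
    using strict_mono_on_leD[OF m(1), of i N] m(3) assms(2) by simp
qed

lemma gll_nodes_less:
  assumes "gll_nodes N xi" "j < N"
  shows "xi j < xi (Suc j)"
  using assms strict_mono_onD[of "{..N}" xi j "Suc j"] by (simp add: gll_nodes_def)

lemma mem_refK: "x \<in> refK \<longleftrightarrow> -1 \<le> x $ 1 \<and> x $ 1 \<le> 1 \<and> -1 \<le> x $ 2 \<and> x $ 2 \<le> 1"
  by (auto simp: refK_def mem_box_cart forall_2)

lemma vertical_segment:
  fixes a b c :: real
  assumes "a < b"
  shows "{x :: real^2. x $ 1 = c \<and> x $ 2 \<in> {a..b}} =
    (\<lambda>t. vector [c, a] + t *\<^sub>R vector [0, b - a]) ` {0..1}"
proof (intro equalityI subsetI)
  fix x :: "real^2" assume "x \<in> {x. x $ 1 = c \<and> x $ 2 \<in> {a..b}}"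
  then show "x \<in> (\<lambda>t. vector [c, a] + t *\<^sub>R vector [0, b - a]) ` {0..1}"
    using assms by (intro image_eqI[of _ _ "(x $ 2 - a) / (b - a)"]) (simp_all add: vec_eq_iff forall_2)
next
  fix x :: "real^2" assume "x \<in> (\<lambda>t. vector [c, a] + t *\<^sub>R vector [0, b - a]) ` {0..1}"
  then obtain t where t: "0 \<le> t" "t \<le> 1" "x = vector [c, a] + t *\<^sub>R vector [0, b - a]"
    by auto
  moreover have "t * (b - a) \<le> b - a"
    using assms t(1,2) by (intro mult_left_le_one_le) simp_all
  then have "a + t * (b - a) \<le> b"
    by linarith
  ultimately show "x \<in> {x. x $ 1 = c \<and> x $ 2 \<in> {a..b}}"
    using assms by simp
qed

lemma horizontal_segment:
  fixes a b c :: real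
  assumes "a < b"
  shows "{x :: real^2. x $ 2 = c \<and> x $ 1 \<in> {a..b}} =
    (\<lambda>t. vector [a, c] + t *\<^sub>R vector [b - a, 0]) ` {0..1}"
proof (intro equalityI subsetI)
  fix x :: "real^2" assume "x \<in> {x. x $ 2 = c \<and> x $ 1 \<in> {a..b}}"
  then show "x \<in> (\<lambda>t. vector [a, c] + t *\<^sub>R vector [b - a, 0]) ` {0..1}"
    using assms by (intro image_eqI[of _ _ "(x $ 1 - a) / (b - a)"]) (simp_all add: vec_eq_iff forall_2)
next
  fix x :: "real^2" assume "x \<in> (\<lambda>t. vector [a, c] + t *\<^sub>R vector [b - a, 0]) ` {0..1}"
  then obtain t where t: "0 \<le> t" "t \<le> 1" "x = vector [a, c] + t *\<^sub>R vector [b - a, 0]"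
    by auto
  moreover have "t * (b - a) \<le> b - a"
    using assms t(1,2) by (intro mult_left_le_one_le) simp_all
  then have "a + t * (b - a) \<le> b"
    by linarith
  ultimately show "x \<in> {x. x $ 2 = c \<and> x $ 1 \<in> {a..b}}"
    using assms by simp
qed

text \<open>Brings vertical and horizontal edges into one affine form, so that a single
  parametrisation argument treats both.\<close>

lemma ref_edge_segment:
  assumes N: "gll_nodes N xi" and "e \<in> ref_edges N xi"
  obtains p d where "d \<noteq> 0" "e = (\<lambda>t. p + t *\<^sub>R d) ` {0..1}" "e \<subseteq> refK"
proof -
  consider (v) i j where "i \<le> N" "j < N" "e = {x. x $ 1 = xi i \<and> x $ 2 \<in> {xi j .. xi (Suc j)}}"
    | (h) i j where "i \<le> N" "j < N" "e = {x. x $ 2 = xi i \<and> x $ 1 \<in> {xi j .. xi (Suc j)}}"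
    using assms(2) unfolding ref_edges_def by blast
  then show thesis
  proof cases
    case v
    have "e \<subseteq> refK"
      unfolding v(3) using gll_nodes_bounds[OF N v(1)] gll_nodes_bounds[OF N, of j]
        gll_nodes_bounds[OF N, of "Suc j"] v(2) by (auto simp: mem_refK)
    moreover have "vector [0, xi (Suc j) - xi j] \<noteq> (0 :: real^2)"
      using gll_nodes_less[OF N v(2)] by (simp add: vec_eq_iff forall_2)
    moreover note v(3)[unfolded vertical_segment[OF gll_nodes_less[OF N v(2)]]]
    ultimately show thesis
      by (intro that)
  next
    case h
    have "e \<subseteq> refK"
      unfolding h(3) using gll_nodes_bounds[OF N h(1)] gll_nodes_bounds[OF N, of j]
        gll_nodes_bounds[OF N, of "Suc j"] h(2) by (auto simp: mem_refK)
    moreover have "vector [xi (Suc j) - xi j, 0] \<noteq> (0 :: real^2)"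
      using gll_nodes_less[OF N h(2)] by (simp add: vec_eq_iff forall_2)
    moreover note h(3)[unfolded horizontal_segment[OF gll_nodes_less[OF N h(2)]]]
    ultimately show thesis
      by (intro that)
  qed
qed

text \<open>\<open>Z\<close> takes finitely many values, each cut out by finitely many measurable
  membership conditions. \<open>P\<close> is arbitrary, so it may even involve a choice from the
  set.\<close>

lemma sets_Collect_finite_valued:
  fixes Z :: "'a \<Rightarrow> 'b set"
  assumes T: "finite T" "\<And>x. Z x \<subseteq> T" and Z: "\<And>p. p \<in> T \<Longrightarrow> {x \<in> space M. p \<in> Z x} \<in> sets M"
  shows "{x \<in> space M. P (Z x)} \<in> sets M"
proof -
  have "P (Z x) \<longleftrightarrow> (\<exists>S\<in>{S \<in> Pow T. P S}. \<forall>p\<in>T. p \<in> Z x \<longleftrightarrow> p \<in> S)" for x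
  proof
    assume "P (Z x)"
    then show "\<exists>S\<in>{S \<in> Pow T. P S}. \<forall>p\<in>T. p \<in> Z x \<longleftrightarrow> p \<in> S"
      using T(2)[of x] by (intro bexI[of _ "Z x"]) simp_all
  next
    assume "\<exists>S\<in>{S \<in> Pow T. P S}. \<forall>p\<in>T. p \<in> Z x \<longleftrightarrow> p \<in> S"
    then obtain S where S: "S \<subseteq> T" "P S" "\<forall>p\<in>T. p \<in> Z x \<longleftrightarrow> p \<in> S"
      by blast
    then have "Z x = S"
      using T(2)[of x] by blast
    with S(2) show "P (Z x)" by simp
  qed
  moreover have "{x \<in> space M. \<exists>S\<in>{S \<in> Pow T. P S}. \<forall>p\<in>T. p \<in> Z x \<longleftrightarrow> p \<in> S} \<in> sets M"
  proof (intro sets.sets_Collect_finite_Ex sets.sets_Collect_finite_All)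
    show "{x \<in> space M. (p \<in> Z x) = (p \<in> S)} \<in> sets M" if "p \<in> T" for p S
      using Z[OF that] sets.sets_Collect_neg[OF Z[OF that]] by (cases "p \<in> S") simp_all
  qed (use T(1) in auto)
  ultimately show ?thesis
    by simp
qed

section \<open>Edges of the mesh and boundary integrals\<close>

context meshed
begin

text \<open>By the chain rule the velocity is the Jacobian applied to \<open>d\<close>: continuous,
  and nonzero because the Jacobian is invertible.\<close>

lemma regular_param_elt_map:
  assumes "d \<noteq> 0" and e: "(\<lambda>t. p + t *\<^sub>R d) ` {0..1} \<subseteq> refK"
  shows "regular_param (\<lambda>t. \<Phi> m (p + t *\<^sub>R d)) (\<Phi> m ` (\<lambda>t. p + t *\<^sub>R d) ` {0..1})"
proof -
  let ?l = "\<lambda>t. p + t *\<^sub>R d"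
  have K: "?l t \<in> refK" if "t \<in> {0..1}" for t
    using e that by (rule image_subset_iff[THEN iffD1, rule_format])
  have vd: "((\<lambda>t. \<Phi> m (?l t)) has_vector_derivative jac \<Phi> m (?l t) *v d) (at t within {0..1})"
    if "t \<in> {0..1}" for t
  proof -
    have "(?l has_derivative (\<lambda>h. h *\<^sub>R d)) (at t within {0..1})"
      by (auto intro!: derivative_eq_intros)
    from has_derivative_compose[OF this has_derivative_jac[OF K[OF that], of m]]
    show ?thesis
      by (simp add: has_vector_derivative_def matrix_vector_mult_scaleR)
  qed
  have vd': "vector_derivative (\<lambda>t. \<Phi> m (?l t)) (at t within {0..1}) = jac \<Phi> m (?l t) *v d"
    if "t \<in> {0..1}" for t
    using vector_derivative_within_cbox[of 0 1 t] vd[OF that] that by simp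
  have nz: "jac \<Phi> m (?l t) *v d \<noteq> 0" if "t \<in> {0..1}" for t
  proof
    have det: "det (jac \<Phi> m (?l t)) \<noteq> 0"
      using det_jac[OF K[OF that], of m] by simp
    assume "jac \<Phi> m (?l t) *v d = 0"
    then have "(matrix_inv (jac \<Phi> m (?l t)) ** jac \<Phi> m (?l t)) *v d = 0"
      by (simp add: matrix_vector_mul_assoc[symmetric])
    then show False
      using \<open>d \<noteq> 0\<close> unfolding matrix_inv_2(2)[OF det] by simp
  qed
  have "continuous_on {0..1} (\<lambda>t. jac \<Phi> m (?l t) $ i $ j)" for i j
  proof (rule continuous_on_compose2[OF continuous_on_jac_nth _ e])
    show "continuous_on {0..1} ?l"
      by (intro continuous_on_add continuous_on_scaleR continuous_on_const continuous_on_id)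
  qed
  then have "continuous_on {0..1} (\<lambda>t. jac \<Phi> m (?l t) $ i $ 1 * d $ 1 + jac \<Phi> m (?l t) $ i $ 2 * d $ 2)" for i
    by (intro continuous_on_add continuous_on_mult continuous_on_const)
  then have "continuous_on {0..1} (\<lambda>t. jac \<Phi> m (?l t) *v d)"
    unfolding matrix_vector_mult_def sum_2 by (rule continuous_on_vec_lambda)
  then have "continuous_on {0..1} (\<lambda>t. vector_derivative (\<lambda>t. \<Phi> m (?l t)) (at t within {0..1}))"
    by (rule continuous_on_eq) (simp add: vd')
  moreover have "inj_on (\<lambda>t. \<Phi> m (?l t)) {0..1}"
  proof (rule inj_onI)
    fix s t :: real assume "s \<in> {0..1}" "t \<in> {0..1}" "\<Phi> m (?l s) = \<Phi> m (?l t)"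
    then have "?l s = ?l t"
      using inj_onD[OF inj_on_refK[of m]] K by metis
    then show "s = t"
      using \<open>d \<noteq> 0\<close> by simp
  qed
  moreover have "(\<lambda>t. \<Phi> m (?l t)) differentiable (at t within {0..1})" if "t \<in> {0..1}" for t
    using vd[OF that] by (rule differentiableI_vector)
  ultimately show ?thesis
    unfolding regular_param_def using vd' nz by (simp add: image_image)
qed

text \<open>Ensures that the parametrisation chosen in \<open>arc_integral\<close> really is
  one.\<close>

lemma regular_param_small_edge:
  assumes N: "gll_nodes N xi" and "C \<in> small_edges N xi \<Phi>"
  shows "\<exists>g. regular_param g C"
proof -
  obtain m e where "e \<in> ref_edges N xi" "C = \<Phi> m ` e"
    using assms(2) unfolding small_edges_def by blast
  moreover obtain p d where "d \<noteq> 0" "e = (\<lambda>t. p + t *\<^sub>R d) ` {0..1}" "e \<subseteq> refK"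
    using ref_edge_segment[OF N \<open>e \<in> ref_edges N xi\<close>] .
  ultimately show ?thesis
    using regular_param_elt_map[of d p m] by blast
qed

lemma bnd_integral_cong:
  assumes "gll_nodes N xi" and f: "\<And>x. x \<in> frontier \<Omega> - vertices \<Phi> \<Longrightarrow> f x = h x"
  shows "bnd_integral N xi \<Omega> \<Phi> f = bnd_integral N xi \<Omega> \<Phi> h"
  unfolding bnd_integral_def
proof (rule sum.cong[OF refl])
  fix C assume "C \<in> bnd_edges N xi \<Omega> \<Phi>"
  then have C: "C \<in> small_edges N xi \<Phi>" "C \<subseteq> frontier \<Omega>"
    by (simp_all add: bnd_edges_def)
  show "arc_integral C f = arc_integral C h"
    by (rule arc_integral_cong[OF regular_param_small_edge[OF assms(1) C(1)] finite_vertices[of \<Phi>]])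
       (use C(2) in \<open>auto intro!: f\<close>)
qed

lemma bounded_borel_on_mono:
  assumes "bounded_borel_on Y f" "X \<subseteq> Y"
  shows "bounded_borel_on X f"
  using assms unfolding bounded_borel_on_def by blast

lemma bnd_integral_add:
  assumes "gll_nodes N xi"
    and "bounded_borel_on (frontier \<Omega> - vertices \<Phi>) f" "bounded_borel_on (frontier \<Omega> - vertices \<Phi>) h"
  shows "bnd_integral N xi \<Omega> \<Phi> (\<lambda>x. a * f x + h x) =
    a * bnd_integral N xi \<Omega> \<Phi> f + bnd_integral N xi \<Omega> \<Phi> h"
proof -
  have "arc_integral C (\<lambda>x. a * f x + h x) = a * arc_integral C f + arc_integral C h"
    if "C \<in> bnd_edges N xi \<Omega> \<Phi>" for C
  proof -
    have C: "C \<in> small_edges N xi \<Phi>" "C - vertices \<Phi> \<subseteq> frontier \<Omega> - vertices \<Phi>"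
      using that by (auto simp: bnd_edges_def)
    show ?thesis
      by (rule arc_integral_add[OF regular_param_small_edge[OF assms(1) C(1)] finite_vertices[of \<Phi>]
            bounded_borel_on_mono[OF assms(2) C(2)] bounded_borel_on_mono[OF assms(3) C(2)]])
  qed
  then show ?thesis
    by (simp add: bnd_integral_def sum.distrib sum_distrib_left)
qed

section \<open>The side chosen at a boundary point, and measurability of normal traces\<close>

definition touching_sides :: "real^2 \<Rightarrow> ('m \<times> (real^2)) set" where
  "touching_sides x = {(m, a). a \<in> ref_normals \<and> x \<in> \<Phi> m ` ref_side a}"

lemma bnd_side_eq: "bnd_side \<Phi> x = (SOME p. p \<in> touching_sides x)"
  unfolding bnd_side_def touching_sides_def by simp

text \<open>A frontier point lies in some closed element but in no open one, as open elements are
  contained in the interior of the domain; its preimage thus lies on a side of the square.\<close>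

lemma bnd_side_touching:
  assumes "x \<in> frontier \<Omega>"
  shows "bnd_side \<Phi> x \<in> touching_sides x"
proof -
  have "x \<in> (\<Union>m. elt \<Phi> m)"
    using mesh assms by (auto simp: mesh_def frontier_def)
  then obtain m \<xi> where \<xi>: "x = \<Phi> m \<xi>" "\<xi> \<in> refK"
    by (auto simp: elt_def)
  have "open_elt \<Phi> m \<subseteq> interior \<Omega>"
    using mesh open_open_elt by (intro interior_maximal) (simp_all add: mesh_def)
  then have "x \<notin> open_elt \<Phi> m"
    using assms by (auto simp: frontier_def)
  then have "\<xi> \<notin> interior refK"
    using \<xi>(1) by (auto simp: open_elt_def)
  then obtain a where "a \<in> ref_normals" "\<xi> \<in> ref_side a"
    using ref_side_cover \<xi>(2) by blast
  then have "(m, a) \<in> touching_sides x"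
    using \<xi>(1) by (auto simp: touching_sides_def)
  then show ?thesis
    unfolding bnd_side_eq by (rule someI)
qed

lemma closed_elt_side: "closed (\<Phi> m ` ref_side a)"
proof (rule compact_imp_closed, rule compact_continuous_image)
  have "ref_side a \<subseteq> refK"
    by (auto simp: ref_side_def)
  then show "continuous_on (ref_side a) (\<Phi> m)"
    by (rule continuous_on_subset[OF continuous_on_elt_map])
  have "compact (refK \<inter> ref_side a)"
    by (rule compact_Int_closed[OF compact_refK closed_ref_side])
  then show "compact (ref_side a)"
    using \<open>ref_side a \<subseteq> refK\<close> by (simp add: Int_absorb1)
qed

text \<open>At points where several sides meet, \<open>bnd_side\<close> makes an arbitrary choice; it is still
  Borel because it depends on the point only through the finite set of sides that contain it.\<close>

lemma borel_bnd_side: "{x. bnd_side \<Phi> x = p} \<in> sets borel"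
proof -
  have "{x \<in> space borel. (SOME p. p \<in> touching_sides x) = p} \<in> sets borel"
  proof (rule sets_Collect_finite_valued[where Z = touching_sides and P = "\<lambda>S. (SOME p. p \<in> S) = p"])
    show "finite ((UNIV :: 'm set) \<times> ref_normals)"
      by (simp add: finite_ref_normals)
    show "touching_sides x \<subseteq> UNIV \<times> ref_normals" for x
      by (auto simp: touching_sides_def)
    fix p :: "'m \<times> (real^2)"
    obtain m a where p: "p = (m, a)" by (cases p)
    have "{x. p \<in> touching_sides x} = (if a \<in> ref_normals then \<Phi> m ` ref_side a else {})"
      by (auto simp: touching_sides_def p)
    also have "\<dots> \<in> sets borel"
      using closed_elt_side by simp
    finally show "{x \<in> space borel. p \<in> touching_sides x} \<in> sets borel"
      by simp
  qed
  then show ?thesis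
    by (simp add: bnd_side_eq)
qed

text \<open>The formula for the normal makes sense on the whole closed element, using the Jacobian
  at the preimage, and not only on the side concerned.\<close>

lemma continuous_on_elt_normal:
  assumes "a \<noteq> 0"
  shows "continuous_on (elt \<Phi> m) (elt_normal \<Phi> m a)"
proof -
  let ?J = "\<lambda>x. jac \<Phi> m (inv_into refK (\<Phi> m) x)"
  have K: "inv_into refK (\<Phi> m) x \<in> refK" if "x \<in> elt \<Phi> m" for x
    using that by (auto simp: elt_def intro!: inv_into_into)
  then have det: "det (?J x) \<noteq> 0" if "x \<in> elt \<Phi> m" for x
    using det_jac[of "inv_into refK (\<Phi> m) x" m] that by simp
  have "continuous_on (elt \<Phi> m) (\<lambda>x. ?J x $ i $ j)" for i j
    by (rule continuous_on_compose2[OF continuous_on_jac_nth continuous_on_inv_elt_map]) (use K in auto)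
  then have "continuous_on (elt \<Phi> m) (\<lambda>x. matrix_inv (?J x) $ i $ j)" for i j
    by (rule continuous_on_matrix_inv_2) (rule det)
  then have "continuous_on (elt \<Phi> m)
      (\<lambda>x. matrix_inv (?J x) $ 1 $ i * a $ 1 + matrix_inv (?J x) $ 2 $ i * a $ 2)" for i
    by (intro continuous_on_add continuous_on_mult continuous_on_const)
  then have "continuous_on (elt \<Phi> m)
      (\<lambda>x. \<chi> i. matrix_inv (?J x) $ 1 $ i * a $ 1 + matrix_inv (?J x) $ 2 $ i * a $ 2)"
    by (rule continuous_on_vec_lambda)
  then have "continuous_on (elt \<Phi> m) (\<lambda>x. transpose (matrix_inv (?J x)) *v a)"
    by (simp add: matrix_vector_mult_def sum_2 transpose_def)
  then show ?thesis
    unfolding elt_normal_def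
    by (rule continuous_on_sgn) (use matrix_inv_transpose_mult_nonzero det assms in blast)
qed

lemma normal_trace_eq:
  "normal_trace \<Phi> q x = elt_trace \<Phi> (fst (bnd_side \<Phi> x)) q x \<bullet>
    elt_normal \<Phi> (fst (bnd_side \<Phi> x)) (snd (bnd_side \<Phi> x)) x"
  by (simp add: normal_trace_def outer_normal_def split_beta)

lemma bnd_side_elt:
  assumes "x \<in> frontier \<Omega>"
  shows "x \<in> elt \<Phi> (fst (bnd_side \<Phi> x))"
  using bnd_side_touching[OF assms] by (auto simp: touching_sides_def elt_def ref_side_def)

lemma normal_trace_add:
  assumes "pw_continuous \<Phi> p" "pw_continuous \<Phi> q" "x \<in> frontier \<Omega>"
  shows "normal_trace \<Phi> (\<lambda>x. a *\<^sub>R p x + q x) x = a * normal_trace \<Phi> p x + normal_trace \<Phi> q x"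
  by (simp add: normal_trace_eq elt_trace_add[OF assms(1,2) bnd_side_elt[OF assms(3)]] inner_add_left)

lemma normal_trace_cong:
  assumes "pw_continuous \<Phi> p" "\<And>x. x \<in> broken \<Phi> \<Longrightarrow> p x = q x" "x \<in> frontier \<Omega>"
  shows "normal_trace \<Phi> p x = normal_trace \<Phi> q x"
  by (simp add: normal_trace_eq elt_trace_cong[OF assms(1,2) bnd_side_elt[OF assms(3)]])

lemma bounded_borel_on_indicator:
  fixes X :: "(real^2) set"
  assumes "compact X" "continuous_on X f"
  shows "bounded_borel_on Y (\<lambda>x. indicat_real X x * f x)"
proof -
  have "(\<lambda>x. indicat_real X x *\<^sub>R f x) \<in> borel_measurable borel"
    by (rule borel_measurable_continuous_on_indicator[OF borel_closed[OF compact_imp_closed[OF assms(1)]] assms(2)])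
  moreover obtain b where "\<And>x. x \<in> X \<Longrightarrow> norm (f x) \<le> b"
    using compact_imp_bounded[OF compact_continuous_image[OF assms(2,1)]] unfolding bounded_iff by auto
  \<comment> \<open>The absolute value covers an empty \<open>X\<close>, for which \<open>b\<close>
    may be negative.\<close>
  then have "norm (indicat_real X x * f x) \<le> \<bar>b\<bar>" for x
    by (cases "x \<in> X") (fastforce simp: indicator_def intro: order_trans[OF _ abs_ge_self])+
  then have "bounded (range (\<lambda>x. indicat_real X x * f x))"
    unfolding bounded_iff by blast
  ultimately show ?thesis
    unfolding bounded_borel_on_def by (intro bexI[of _ "\<lambda>x. indicat_real X x * f x"]) simp_all
qed

lemma bounded_borel_on_indicator_set:
  assumes "X \<in> sets borel"
  shows "bounded_borel_on Y (indicat_real X)"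
proof -
  have "norm (indicat_real X x) \<le> 1" for x
    by (simp add: indicator_def)
  then have "bounded (range (indicat_real X))"
    unfolding bounded_iff by blast
  then show ?thesis
    unfolding bounded_borel_on_def using assms
    by (intro bexI[of _ "indicat_real X"]) simp_all
qed

text \<open>A finite sum over all pairs of element and side: the Borel indicator of the points where
  that pair is chosen, times an expression continuous on the closed element and cut off outside
  it.\<close>

lemma bounded_borel_normal_trace:
  assumes "pw_continuous \<Phi> q"
  shows "bounded_borel_on (frontier \<Omega>) (normal_trace \<Phi> q)"
proof -
  define h where "h = (\<lambda>(m, a) x. elt_trace \<Phi> m q x \<bullet> elt_normal \<Phi> m a x)"
  have T: "finite ((UNIV :: 'm set) \<times> ref_normals)"
    by (simp add: finite_ref_normals)
  have "bounded_borel_on (frontier \<Omega>) (\<lambda>x. \<Sum>p\<in>UNIV \<times> ref_normals.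
      indicat_real {x. bnd_side \<Phi> x = p} x * (indicat_real (elt \<Phi> (fst p)) x * h p x))"
  proof (rule bounded_borel_on_sum, rule bounded_borel_on_mult)
    fix p :: "'m \<times> (real^2)" assume "p \<in> UNIV \<times> ref_normals"
    then have "continuous_on (elt \<Phi> (fst p)) (h p)"
      unfolding h_def split_beta
      by (intro continuous_on_inner continuous_on_elt_trace[OF assms] continuous_on_elt_normal ref_normals_nonzero) auto
    then show "bounded_borel_on (frontier \<Omega>) (\<lambda>x. indicat_real (elt \<Phi> (fst p)) x * h p x)"
      by (rule bounded_borel_on_indicator[OF compact_elt])
    show "bounded_borel_on (frontier \<Omega>) (indicat_real {x. bnd_side \<Phi> x = p})"
      by (rule bounded_borel_on_indicator_set[OF borel_bnd_side])
  qed
  then show ?thesis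
  proof (rule bounded_borel_on_cong)
    fix x assume x: "x \<in> frontier \<Omega>"
    let ?p = "bnd_side \<Phi> x"
    have p: "?p \<in> UNIV \<times> ref_normals"
      using bnd_side_touching[OF x] by (auto simp: touching_sides_def)
    have "(\<Sum>p\<in>UNIV \<times> ref_normals.
        indicat_real {x. bnd_side \<Phi> x = p} x * (indicat_real (elt \<Phi> (fst p)) x * h p x)) =
      (\<Sum>p\<in>UNIV \<times> ref_normals. if p = ?p then indicat_real (elt \<Phi> (fst ?p)) x * h ?p x else 0)"
      by (rule sum.cong) (auto simp: indicator_def)
    also have "\<dots> = indicat_real (elt \<Phi> (fst ?p)) x * h ?p x"
      using p T by (simp add: sum.delta')
    also have "\<dots> = normal_trace \<Phi> q x"
      using bnd_side_elt[OF x] by (simp add: normal_trace_eq h_def split_beta)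
    finally show "normal_trace \<Phi> q x = (\<Sum>p\<in>UNIV \<times> ref_normals.
        indicat_real {x. bnd_side \<Phi> x = p} x * (indicat_real (elt \<Phi> (fst p)) x * h p x))" ..
  qed
qed

lemma bnd_linear_functional:
  assumes N: "gll_nodes N xi" and "bounded_borel_on (frontier \<Omega> - vertices \<Phi>) s"
  shows "linear_functional_on (broken \<Phi>) (D_space N \<Phi>)
    (\<lambda>q. bnd_integral N xi \<Omega> \<Phi> (\<lambda>x. s x * normal_trace \<Phi> q x))"
  unfolding linear_functional_on_def
proof (intro conjI ballI allI impI)
  fix p q a assume pq: "p \<in> D_space N \<Phi>" "q \<in> D_space N \<Phi>"
  note pw = pq[THEN D_space_pw_continuous]
  have b: "bounded_borel_on (frontier \<Omega> - vertices \<Phi>) (\<lambda>x. s x * normal_trace \<Phi> r x)"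
    if "pw_continuous \<Phi> r" for r
    by (rule bounded_borel_on_mult[OF assms(2) bounded_borel_on_mono[OF bounded_borel_normal_trace[OF that]]]) blast
  have "bnd_integral N xi \<Omega> \<Phi> (\<lambda>x. s x * normal_trace \<Phi> (\<lambda>x. a *\<^sub>R p x + q x) x) =
    bnd_integral N xi \<Omega> \<Phi> (\<lambda>x. a * (s x * normal_trace \<Phi> p x) + s x * normal_trace \<Phi> q x)"
    by (rule bnd_integral_cong[OF N]) (simp add: normal_trace_add[OF pw] distrib_left mult.left_commute)
  also have "\<dots> = a * bnd_integral N xi \<Omega> \<Phi> (\<lambda>x. s x * normal_trace \<Phi> p x) +
      bnd_integral N xi \<Omega> \<Phi> (\<lambda>x. s x * normal_trace \<Phi> q x)"
    by (rule bnd_integral_add[OF N b[OF pw(1)] b[OF pw(2)]])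
  finally show "bnd_integral N xi \<Omega> \<Phi> (\<lambda>x. s x * normal_trace \<Phi> (\<lambda>x. a *\<^sub>R p x + q x) x) = \<dots>" .
next
  fix p q assume pq: "p \<in> D_space N \<Phi>" "q \<in> D_space N \<Phi>" "\<forall>x\<in>broken \<Phi>. p x = q x"
  show "bnd_integral N xi \<Omega> \<Phi> (\<lambda>x. s x * normal_trace \<Phi> p x) =
    bnd_integral N xi \<Omega> \<Phi> (\<lambda>x. s x * normal_trace \<Phi> q x)"
  proof (rule bnd_integral_cong[OF N])
    fix x assume "x \<in> frontier \<Omega> - vertices \<Phi>"
    then have "normal_trace \<Phi> p x = normal_trace \<Phi> q x"
      using pq(3) by (intro normal_trace_cong[OF D_space_pw_continuous[OF pq(1)]]) simp_all
    then show "s x * normal_trace \<Phi> p x = s x * normal_trace \<Phi> q x" by simp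
  qed
qed

text \<open>A dual boundary function is, off the vertices, a linear combination of normal traces;
  the entries of \<open>matrix_inv\<close> enter as real constants.\<close>

lemma dual_bnd_space_bounded_borel:
  fixes edge :: "'e::finite \<Rightarrow> (real^2) set" and bnd :: "'b::finite \<Rightarrow> 'e"
  assumes "s \<in> dual_bnd_space N xi \<Omega> \<Phi> edge \<nu> bnd \<Psi>1" and "\<And>e. \<Psi>1 e \<in> D_space N \<Phi>"
  shows "bounded_borel_on (frontier \<Omega> - vertices \<Phi>) s"
proof -
  define \<Psi>b where "\<Psi>b = bnd_basis \<Phi> edge \<nu> bnd \<Psi>1"
  obtain c :: "real^'b" where
    c: "\<forall>x \<in> frontier \<Omega> - vertices \<Phi>.
      s x = (\<Sum>b\<in>UNIV. c $ b * dual_basis (bnd_mass_matrix N xi \<Omega> \<Phi> \<Psi>b) \<Psi>b b x)"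
    using assms(1) unfolding dual_bnd_space_def Let_def \<Psi>b_def by blast
  have "bounded_borel_on (frontier \<Omega> - vertices \<Phi>) (\<Psi>b b)" for b
    unfolding \<Psi>b_def bnd_basis_def
    by (intro bounded_borel_on_sum bounded_borel_on_mult bounded_borel_on_const
        bounded_borel_on_mono[OF bounded_borel_normal_trace[OF D_space_pw_continuous[OF assms(2)]]]) blast
  then have "bounded_borel_on (frontier \<Omega> - vertices \<Phi>)
      (\<lambda>x. \<Sum>b\<in>UNIV. c $ b * dual_basis (bnd_mass_matrix N xi \<Omega> \<Phi> \<Psi>b) \<Psi>b b x)"
    unfolding dual_basis_def real_scaleR_def
    by (intro bounded_borel_on_sum bounded_borel_on_mult bounded_borel_on_const)
  then show ?thesis
    by (rule bounded_borel_on_cong) (use c in blast)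
qed

end

section \<open>The dual gradient and the duality of the two problems\<close>

locale discretization = meshed \<Omega> \<Phi>
  for \<Omega> :: "(real^2) set" and \<Phi> :: "'m::finite \<Rightarrow> real^2 \<Rightarrow> real^2" +
  fixes N :: nat and xi :: "nat \<Rightarrow> real"
    and edge :: "'e::finite \<Rightarrow> (real^2) set" and \<nu> :: "'e \<Rightarrow> real^2 \<Rightarrow> real^2"
    and cell :: "'c::finite \<Rightarrow> (real^2) set"
    and \<Psi>1 :: "'e \<Rightarrow> real^2 \<Rightarrow> real^2" and \<Psi>2 :: "'c \<Rightarrow> real^2 \<Rightarrow> real"
    and E :: "real^'e^'c"
  assumes gll: "gll_nodes N xi"
    and basis1: "dof_basis (broken \<Phi>) (D_space N \<Phi>) (dof1 \<Phi> edge \<nu>) \<Psi>1"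
    and basis2: "dof_basis (broken \<Phi>) (S_space N \<Phi>) (dof2 cell) \<Psi>2"
    and incidence: "incidence_matrix N \<Phi> edge \<nu> \<Psi>2 E"
begin

lemma divg_expand:
  assumes "q \<in> D_space N \<Phi>" "x \<in> broken \<Phi>"
  shows "divg q x = (\<Sum>c\<in>UNIV. (E *v dof1 \<Phi> edge \<nu> q) $ c *\<^sub>R \<Psi>2 c x)"
  using incidence assms by (simp add: incidence_matrix_def mult.commute)

lemma divg_S_space:
  assumes "q \<in> D_space N \<Phi>"
  shows "divg q \<in> S_space N \<Phi>"
proof (rule S_space_cong[OF linear_closed_sum[OF S_space_linear_closed]])
  show "\<Psi>2 c \<in> S_space N \<Phi>" for c
    by (rule dof_basis_in[OF basis2])
  show "(\<lambda>_. 0) \<in> S_space N \<Phi>"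
    by (rule dof_basis_zero[OF basis2 S_space_linear_closed])
qed (use divg_expand[OF assms] in simp_all)

text \<open>Derived from linearity of the degrees of freedom through the incidence matrix, without
  touching derivatives.\<close>

lemma divg_add:
  assumes "p \<in> D_space N \<Phi>" "q \<in> D_space N \<Phi>" "x \<in> broken \<Phi>"
  shows "divg (\<lambda>x. a *\<^sub>R p x + q x) x = a *\<^sub>R divg p x + divg q x"
  unfolding divg_expand[OF assms(1,3)] divg_expand[OF assms(2,3)]
    divg_expand[OF linear_closedD[OF D_space_linear_closed assms(1,2)] assms(3)]
    dof_basis_add[OF basis1 D_space_linear_closed assms(1,2)]
  by (simp add: matrix_vector_right_distrib matrix_vector_mult_scaleR sum.distrib
      distrib_right sum_distrib_left mult.assoc)

text \<open>Fields that agree on \<open>broken \<Phi>\<close> have the same coefficients, hence the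
  same divergence.\<close>

lemma divg_cong:
  assumes "p \<in> D_space N \<Phi>" "q \<in> D_space N \<Phi>" "\<And>x. x \<in> broken \<Phi> \<Longrightarrow> p x = q x" "x \<in> broken \<Phi>"
  shows "divg p x = divg q x"
proof -
  have "dof1 \<Phi> edge \<nu> p = dof1 \<Phi> edge \<nu> q"
    by (rule dof_basis_unique[OF basis1])
       (simp only: dof_basis_expand[OF basis1 assms(1), symmetric]
          dof_basis_expand[OF basis1 assms(2), symmetric] assms(3))
  then show ?thesis
    using divg_expand[OF assms(1,4)] divg_expand[OF assms(2,4)] by simp
qed

lemmas D_add = linear_closedD[OF D_space_linear_closed]
lemmas S_add = linear_closedD[OF S_space_linear_closed]

lemma D_linear: "f \<in> D_space N \<Phi> \<Longrightarrow> linear_functional_on (broken \<Phi>) (D_space N \<Phi>) (\<lambda>g. L2_inner \<Omega> g f)"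
  by (erule L2_linear_functional) (rule D_space_pw_continuous)

lemma S_linear: "f \<in> S_space N \<Phi> \<Longrightarrow> linear_functional_on (broken \<Phi>) (S_space N \<Phi>) (\<lambda>g. L2_inner \<Omega> g f)"
  by (erule L2_linear_functional) (rule S_space_pw_continuous)

lemma D_inner_add:
  assumes "f \<in> D_space N \<Phi>" "g \<in> D_space N \<Phi>" "h \<in> D_space N \<Phi>"
  shows "L2_inner \<Omega> (\<lambda>x. a *\<^sub>R f x + g x) h = a * L2_inner \<Omega> f h + L2_inner \<Omega> g h"
    and "L2_inner \<Omega> h (\<lambda>x. a *\<^sub>R f x + g x) = a * L2_inner \<Omega> h f + L2_inner \<Omega> h g"
proof -
  show "L2_inner \<Omega> (\<lambda>x. a *\<^sub>R f x + g x) h = a * L2_inner \<Omega> f h + L2_inner \<Omega> g h"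
    by (rule linear_functional_on_add[OF D_linear[OF assms(3)] assms(1,2)])
  then show "L2_inner \<Omega> h (\<lambda>x. a *\<^sub>R f x + g x) = a * L2_inner \<Omega> h f + L2_inner \<Omega> h g"
    by (simp only: L2_inner_commute[of \<Omega> h])
qed

lemma S_inner_add:
  assumes "f \<in> S_space N \<Phi>" "g \<in> S_space N \<Phi>" "h \<in> S_space N \<Phi>"
  shows "L2_inner \<Omega> (\<lambda>x. a *\<^sub>R f x + g x) h = a * L2_inner \<Omega> f h + L2_inner \<Omega> g h"
    and "L2_inner \<Omega> h (\<lambda>x. a *\<^sub>R f x + g x) = a * L2_inner \<Omega> h f + L2_inner \<Omega> h g"
proof -
  show "L2_inner \<Omega> (\<lambda>x. a *\<^sub>R f x + g x) h = a * L2_inner \<Omega> f h + L2_inner \<Omega> g h"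
    by (rule linear_functional_on_add[OF S_linear[OF assms(3)] assms(1,2)])
  then show "L2_inner \<Omega> h (\<lambda>x. a *\<^sub>R f x + g x) = a * L2_inner \<Omega> h f + L2_inner \<Omega> h g"
    by (simp only: L2_inner_commute[of \<Omega> h])
qed

lemma inner_cong:
  assumes "\<And>x. x \<in> broken \<Phi> \<Longrightarrow> f x = f' x" "\<And>x. x \<in> broken \<Phi> \<Longrightarrow> g x = g' x"
  shows "L2_inner \<Omega> f g = L2_inner \<Omega> f' g'"
  using assms by (rule L2_inner_cong[OF broken_subset negligible_diff_broken])

lemma D_inner_eq_0D:
  assumes "f \<in> D_space N \<Phi>" "L2_inner \<Omega> f f = 0" "x \<in> broken \<Phi>"
  shows "f x = 0"
  using pw_continuous_imp_bcont_on[OF D_space_pw_continuous[OF assms(1)]] assms(2,3)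
  by (rule L2_inner_eq_0D[OF broken_subset negligible_diff_broken open_broken bounded_broken])

lemma S_inner_eq_0D:
  assumes "f \<in> S_space N \<Phi>" "L2_inner \<Omega> f f = 0" "x \<in> broken \<Phi>"
  shows "f x = 0"
  using pw_continuous_imp_bcont_on[OF S_space_pw_continuous[OF assms(1)]] assms(2,3)
  by (rule L2_inner_eq_0D[OF broken_subset negligible_diff_broken open_broken bounded_broken])

section \<open>Existence, uniqueness and linearity of the dual gradient\<close>

text \<open>The property behind the choice in \<open>dual_grad\<close>. Stating linearity for this
  relation avoids comparing chosen values; uniqueness on \<open>broken \<Phi>\<close> carries it
  over.\<close>

definition is_dual_grad :: "(real^2 \<Rightarrow> real) \<Rightarrow> (real^2 \<Rightarrow> real) \<Rightarrow> (real^2 \<Rightarrow> real^2) \<Rightarrow> bool" where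
  "is_dual_grad s sb g \<longleftrightarrow> g \<in> D_space N \<Phi> \<and>
     (\<forall>q \<in> D_space N \<Phi>. L2_inner \<Omega> g q =
        - L2_inner \<Omega> s (divg q) + bnd_integral N xi \<Omega> \<Phi> (\<lambda>x. sb x * normal_trace \<Phi> q x))"

lemma is_dual_gradD:
  assumes "is_dual_grad s sb g"
  shows "g \<in> D_space N \<Phi>"
    and "q \<in> D_space N \<Phi> \<Longrightarrow> L2_inner \<Omega> g q =
        - L2_inner \<Omega> s (divg q) + bnd_integral N xi \<Omega> \<Phi> (\<lambda>x. sb x * normal_trace \<Phi> q x)"
  using assms unfolding is_dual_grad_def by blast+

lemma is_dual_grad_dual_grad:
  assumes s: "s \<in> S_space N \<Phi>" and sb: "bounded_borel_on (frontier \<Omega> - vertices \<Phi>) sb"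
  shows "is_dual_grad s sb (dual_grad N xi \<Omega> \<Phi> s sb)"
proof -
  let ?b = "\<lambda>q. bnd_integral N xi \<Omega> \<Phi> (\<lambda>x. sb x * normal_trace \<Phi> q x)"
  let ?l = "\<lambda>q. - L2_inner \<Omega> s (divg q) + ?b q"
  note b = bnd_linear_functional[OF gll sb]
  have l: "linear_functional_on (broken \<Phi>) (D_space N \<Phi>) ?l"
    unfolding linear_functional_on_def
  proof (intro conjI ballI allI impI)
    fix p q a assume pq: "p \<in> D_space N \<Phi>" "q \<in> D_space N \<Phi>"
    have "L2_inner \<Omega> s (divg (\<lambda>x. a *\<^sub>R p x + q x)) = L2_inner \<Omega> s (\<lambda>x. a *\<^sub>R divg p x + divg q x)"
      by (rule inner_cong[OF refl divg_add[OF pq]])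
    also have "\<dots> = a * L2_inner \<Omega> s (divg p) + L2_inner \<Omega> s (divg q)"
      by (rule S_inner_add(2)[OF divg_S_space[OF pq(1)] divg_S_space[OF pq(2)] s])
    finally show "?l (\<lambda>x. a *\<^sub>R p x + q x) = a * ?l p + ?l q"
      unfolding linear_functional_on_add[OF b pq] by (simp add: algebra_simps)
  next
    fix p q assume pq: "p \<in> D_space N \<Phi>" "q \<in> D_space N \<Phi>" and eq: "\<forall>x\<in>broken \<Phi>. p x = q x"
    have "L2_inner \<Omega> s (divg p) = L2_inner \<Omega> s (divg q)"
      by (rule inner_cong[OF refl divg_cong[OF pq bspec[OF eq]]])
    moreover have "?b p = ?b q"
      by (rule linear_functional_on_cong[OF b pq bspec[OF eq]])
    ultimately show "?l p = ?l q" by simp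
  qed
  have "\<exists>g \<in> D_space N \<Phi>. \<forall>q \<in> D_space N \<Phi>. L2_inner \<Omega> g q = ?l q"
  proof (rule riesz_dof_basis[OF basis1 D_space_linear_closed l])
    show "L2_inner \<Omega> f g = L2_inner \<Omega> g f" for f g :: "real^2 \<Rightarrow> real^2"
      by (rule L2_inner_commute)
  qed (fact D_linear D_inner_eq_0D)+
  then have "\<exists>g. is_dual_grad s sb g"
    unfolding is_dual_grad_def by blast
  then have "is_dual_grad s sb (SOME g. is_dual_grad s sb g)"
    by (rule someI_ex)
  then show ?thesis
    unfolding dual_grad_def is_dual_grad_def .
qed

text \<open>The difference of the two fields is itself an admissible test field, so its norm
  vanishes.\<close>

lemma D_inner_ext:
  assumes "f \<in> D_space N \<Phi>" "g \<in> D_space N \<Phi>"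
    and "\<And>p. p \<in> D_space N \<Phi> \<Longrightarrow> L2_inner \<Omega> f p = L2_inner \<Omega> g p" and "x \<in> broken \<Phi>"
  shows "f x = g x"
proof -
  let ?d = "\<lambda>x. (-1) *\<^sub>R f x + g x"
  have d: "?d \<in> D_space N \<Phi>"
    by (rule D_add[OF assms(1,2)])
  have "L2_inner \<Omega> ?d ?d = 0"
    unfolding D_inner_add(1)[OF assms(1,2) d] using assms(3)[OF d] by simp
  then show ?thesis
    using D_inner_eq_0D[OF d _ assms(4)] by simp
qed

lemma is_dual_grad_unique:
  assumes "is_dual_grad s sb f" "is_dual_grad s sb g" "x \<in> broken \<Phi>"
  shows "f x = g x"
  using D_inner_ext[OF is_dual_gradD(1)[OF assms(1)] is_dual_gradD(1)[OF assms(2)] _ assms(3)]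
    is_dual_gradD(2)[OF assms(1)] is_dual_gradD(2)[OF assms(2)] by simp

text \<open>In this shape it matches the boundary term for the datum
  \<open>\<lambda>_. 0\<close>.\<close>

lemma bnd_integral_zero: "bnd_integral N xi \<Omega> \<Phi> (\<lambda>x. 0 * f x) = 0"
  by (simp add: bnd_integral_def arc_integral_def set_lebesgue_integral_def)

text \<open>Only the first summand has zero boundary datum, so the sum keeps the datum
  \<open>sb\<close>: for fixed datum the dual gradient is affine in the interior function.\<close>

lemma is_dual_grad_add:
  assumes "s \<in> S_space N \<Phi>" "t \<in> S_space N \<Phi>"
    and "is_dual_grad s (\<lambda>_. 0) f" "is_dual_grad t sb g"
  shows "is_dual_grad (\<lambda>x. a *\<^sub>R s x + t x) sb (\<lambda>x. a *\<^sub>R f x + g x)"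
  unfolding is_dual_grad_def
proof (intro conjI ballI)
  note fg = is_dual_gradD(1)[OF assms(3)] is_dual_gradD(1)[OF assms(4)]
  show "(\<lambda>x. a *\<^sub>R f x + g x) \<in> D_space N \<Phi>"
    by (rule D_add[OF fg])
  fix q assume q: "q \<in> D_space N \<Phi>"
  show "L2_inner \<Omega> (\<lambda>x. a *\<^sub>R f x + g x) q = - L2_inner \<Omega> (\<lambda>x. a *\<^sub>R s x + t x) (divg q) +
      bnd_integral N xi \<Omega> \<Phi> (\<lambda>x. sb x * normal_trace \<Phi> q x)"
    unfolding D_inner_add(1)[OF fg q] S_inner_add(1)[OF assms(1,2) divg_S_space[OF q]]
      is_dual_gradD(2)[OF assms(3) q] is_dual_gradD(2)[OF assms(4) q] bnd_integral_zero
    by (simp add: algebra_simps)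
qed

lemma L2_norm_power2: "(L2_norm \<Omega> f)\<^sup>2 = L2_inner \<Omega> f f"
  by (simp add: L2_norm_def L2_inner_nonneg)

section \<open>Duality of the Neumann and Dirichlet problems\<close>

lemma neumann_dirichlet_duality:
  assumes \<phi>b: "bounded_borel_on (frontier \<Omega> - vertices \<Phi>) \<phi>b"
    and q: "q \<in> D_space N \<Phi>"
    and neumann: "\<forall>p \<in> D_space N \<Phi>. L2_inner \<Omega> (divg p) (divg q) + L2_inner \<Omega> p q
             = bnd_integral N xi \<Omega> \<Phi> (\<lambda>x. normal_trace \<Phi> p x * \<phi>b x)"
    and \<phi>: "\<phi> \<in> S_space N \<Phi>"
    and dirichlet: "\<forall>\<eta> \<in> S_space N \<Phi>.
           L2_inner \<Omega> (dual_grad N xi \<Omega> \<Phi> \<eta> (\<lambda>_. 0)) (dual_grad N xi \<Omega> \<Phi> \<phi> \<phi>b)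
             + L2_inner \<Omega> \<eta> \<phi> = 0"
  shows "\<And>x. x \<in> broken \<Phi> \<Longrightarrow> \<phi> x = divg q x"
    and "\<And>x. x \<in> broken \<Phi> \<Longrightarrow> dual_grad N xi \<Omega> \<Phi> \<phi> \<phi>b x = q x"
    and "\<And>s. s \<in> S_space N \<Phi> \<Longrightarrow> Hgrad_norm N xi \<Omega> \<Phi> \<phi> \<phi>b \<le> Hgrad_norm N xi \<Omega> \<Phi> s \<phi>b"
proof -
  let ?g = "dual_grad N xi \<Omega> \<Phi> \<phi> \<phi>b" and ?G0 = "\<lambda>s. dual_grad N xi \<Omega> \<Phi> s (\<lambda>_. 0)"
  have g: "is_dual_grad \<phi> \<phi>b ?g"
    by (rule is_dual_grad_dual_grad[OF \<phi> \<phi>b])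
  have G0: "is_dual_grad s (\<lambda>_. 0) (?G0 s)" if "s \<in> S_space N \<Phi>" for s
    by (rule is_dual_grad_dual_grad[OF that bounded_borel_on_const])
  have dq: "is_dual_grad (divg q) \<phi>b q"
    unfolding is_dual_grad_def
  proof (intro conjI ballI q)
    fix p assume "p \<in> D_space N \<Phi>"
    from bspec[OF neumann this] show "L2_inner \<Omega> q p = - L2_inner \<Omega> (divg q) (divg p) +
        bnd_integral N xi \<Omega> \<Phi> (\<lambda>x. \<phi>b x * normal_trace \<Phi> p x)"
      by (simp add: L2_inner_commute[of \<Omega> q] L2_inner_commute[of \<Omega> "divg q"] mult.commute)
  qed
  note S_q = divg_S_space[OF q]
  define d where "d = (\<lambda>x. (-1) *\<^sub>R divg q x + \<phi> x)"
  have d: "d \<in> S_space N \<Phi>"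
    unfolding d_def by (rule S_add[OF S_q \<phi>])
  let ?e = "?G0 d"
  note e = is_dual_gradD[OF G0[OF d], unfolded bnd_integral_zero]
  \<comment> \<open>The factor 1 only fits the combined form \<open>a *\<^sub>R f x + g x\<close> of
    the linearity lemmas.\<close>
  have "is_dual_grad (\<lambda>x. 1 *\<^sub>R d x + divg q x) \<phi>b (\<lambda>x. 1 *\<^sub>R ?e x + q x)"
    by (rule is_dual_grad_add[OF d S_q G0[OF d] dq])
  moreover have "(\<lambda>x. 1 *\<^sub>R d x + divg q x) = \<phi>"
    by (simp add: d_def)
  ultimately have eq: "?g x = 1 *\<^sub>R ?e x + q x" if "x \<in> broken \<Phi>" for x
    using is_dual_grad_unique[OF g _ that] by simp
  have "L2_inner \<Omega> ?e ?g = L2_inner \<Omega> ?e (\<lambda>x. 1 *\<^sub>R ?e x + q x)"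
    by (rule inner_cong[OF refl eq])
  \<comment> \<open>Discrete integration by parts: \<open>?e\<close> has zero boundary datum, so its
    inner product with \<open>q\<close> is minus that of \<open>d\<close> with
    \<open>divg q\<close>.\<close>
  also have "\<dots> = L2_inner \<Omega> ?e ?e - L2_inner \<Omega> d (divg q)"
    unfolding D_inner_add(2)[OF e(1) q e(1)] e(2)[OF q] by simp
  finally have "L2_inner \<Omega> ?e ?e + (L2_inner \<Omega> d \<phi> - L2_inner \<Omega> d (divg q)) = 0"
    using bspec[OF dirichlet d] by simp
  moreover have "L2_inner \<Omega> d d = L2_inner \<Omega> d \<phi> - L2_inner \<Omega> d (divg q)"
    using S_inner_add(2)[OF S_q \<phi> d, of "-1", folded d_def] by simp
  ultimately have "L2_inner \<Omega> d d = 0"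
    using L2_inner_nonneg[of \<Omega> ?e] L2_inner_nonneg[of \<Omega> d] by linarith
  then show \<phi>_eq: "\<phi> x = divg q x" if "x \<in> broken \<Phi>" for x
    using S_inner_eq_0D[OF d _ that] by (simp add: d_def)
  \<comment> \<open>The defining relation of \<open>q\<close> as dual gradient of
    \<open>divg q\<close> sees that function only inside an integral, so \<open>\<phi>\<close> may
    replace it.\<close>
  have "is_dual_grad \<phi> \<phi>b q"
    unfolding is_dual_grad_def
  proof (intro conjI ballI q)
    fix p assume p: "p \<in> D_space N \<Phi>"
    have "L2_inner \<Omega> \<phi> (divg p) = L2_inner \<Omega> (divg q) (divg p)"
      by (rule inner_cong[OF \<phi>_eq refl])
    then show "L2_inner \<Omega> q p = - L2_inner \<Omega> \<phi> (divg p) +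
        bnd_integral N xi \<Omega> \<Phi> (\<lambda>x. \<phi>b x * normal_trace \<Phi> p x)"
      using is_dual_gradD(2)[OF dq p] by simp
  qed
  then show "?g x = q x" if "x \<in> broken \<Phi>" for x
    using is_dual_grad_unique[OF g _ that] by blast
  show "Hgrad_norm N xi \<Omega> \<Phi> \<phi> \<phi>b \<le> Hgrad_norm N xi \<Omega> \<Phi> s \<phi>b" if s: "s \<in> S_space N \<Phi>" for s
  proof -
    \<comment> \<open>The competitor \<open>s\<close> and \<open>\<phi>\<close> share the boundary
      datum, so their difference is an admissible test function of the Dirichlet problem.\<close>
    define \<eta> where "\<eta> = (\<lambda>x. (-1) *\<^sub>R \<phi> x + s x)"
    have \<eta>: "\<eta> \<in> S_space N \<Phi>"
      unfolding \<eta>_def by (rule S_add[OF \<phi> s])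
    let ?h = "?G0 \<eta>" and ?k = "dual_grad N xi \<Omega> \<Phi> s \<phi>b"
    note h = is_dual_gradD(1)[OF G0[OF \<eta>]] and g1 = is_dual_gradD(1)[OF g]
    have s_eq: "(\<lambda>x. 1 *\<^sub>R \<eta> x + \<phi> x) = s"
      by (simp add: \<eta>_def)
    have "is_dual_grad s \<phi>b (\<lambda>x. 1 *\<^sub>R ?h x + ?g x)"
      using is_dual_grad_add[OF \<eta> \<phi> G0[OF \<eta>] g, of 1] unfolding s_eq .
    then have k: "?k x = 1 *\<^sub>R ?h x + ?g x" if "x \<in> broken \<Phi>" for x
      using is_dual_grad_unique[OF is_dual_grad_dual_grad[OF s \<phi>b] _ that] by blast
    have "L2_inner \<Omega> ?k ?k = L2_inner \<Omega> (\<lambda>x. 1 *\<^sub>R ?h x + ?g x) (\<lambda>x. 1 *\<^sub>R ?h x + ?g x)"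
      by (rule inner_cong[OF k k])
    also have "\<dots> = L2_inner \<Omega> ?h ?h + 2 * L2_inner \<Omega> ?h ?g + L2_inner \<Omega> ?g ?g"
      unfolding D_inner_add(1)[OF h g1 D_add[OF h g1]] D_inner_add(2)[OF h g1 h]
        D_inner_add(2)[OF h g1 g1] using L2_inner_commute[of \<Omega> ?g ?h] by simp
    finally have kk: "L2_inner \<Omega> ?k ?k = \<dots>" .
    have "L2_inner \<Omega> s s = L2_inner \<Omega> (\<lambda>x. 1 *\<^sub>R \<eta> x + \<phi> x) (\<lambda>x. 1 *\<^sub>R \<eta> x + \<phi> x)"
      unfolding s_eq ..
    also have "\<dots> = L2_inner \<Omega> \<eta> \<eta> + 2 * L2_inner \<Omega> \<eta> \<phi> + L2_inner \<Omega> \<phi> \<phi>"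
      unfolding S_inner_add(1)[OF \<eta> \<phi> S_add[OF \<eta> \<phi>]] S_inner_add(2)[OF \<eta> \<phi> \<eta>]
        S_inner_add(2)[OF \<eta> \<phi> \<phi>] using L2_inner_commute[of \<Omega> \<phi> \<eta>] by simp
    finally have "L2_inner \<Omega> s s = \<dots>" .
    \<comment> \<open>The two cross terms add up to twice the left side of the Dirichlet equation
      tested with \<open>\<eta>\<close>, which is zero.\<close>
    with kk have "L2_inner \<Omega> \<phi> \<phi> + L2_inner \<Omega> ?g ?g \<le> L2_inner \<Omega> s s + L2_inner \<Omega> ?k ?k"
      using bspec[OF dirichlet \<eta>] L2_inner_nonneg[of \<Omega> \<eta>] L2_inner_nonneg[of \<Omega> ?h] by linarith
    then show ?thesis
      unfolding Hgrad_norm_def L2_norm_power2 by (rule real_sqrt_le_mono)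
  qed
qed

end

theorem mainTheorem1:
  fixes N :: nat and xi :: "nat \<Rightarrow> real"
    and \<Omega> :: "(real^2) set" and \<Phi> :: "'m::finite \<Rightarrow> real^2 \<Rightarrow> real^2"
    and edge :: "'e::finite \<Rightarrow> (real^2) set" and \<nu> :: "'e \<Rightarrow> real^2 \<Rightarrow> real^2"
    and cell :: "'c::finite \<Rightarrow> (real^2) set" and bnd :: "'b::finite \<Rightarrow> 'e"
    and \<Psi>1 :: "'e \<Rightarrow> real^2 \<Rightarrow> real^2" and \<Psi>2 :: "'c \<Rightarrow> real^2 \<Rightarrow> real"
    and E :: "real^'e^'c"
    and \<phi>b :: "real^2 \<Rightarrow> real" and q :: "real^2 \<Rightarrow> real^2" and \<phi> :: "real^2 \<Rightarrow> real"
  assumes "N \<ge> 1" and "gll_nodes N xi"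
    and "lipschitz_domain \<Omega>" and "mesh \<Omega> \<Phi>"
    and "bij_betw edge UNIV (small_edges N xi \<Phi>)"
    and "\<And>e. unit_normal_field (edge e) (\<nu> e)"
    and "bij_betw cell UNIV (small_cells N xi \<Phi>)"
    and "bij_betw bnd UNIV {e. edge e \<subseteq> frontier \<Omega>}"
    and "dof_basis (broken \<Phi>) (D_space N \<Phi>) (dof1 \<Phi> edge \<nu>) \<Psi>1"
    and "dof_basis (broken \<Phi>) (S_space N \<Phi>) (dof2 cell) \<Psi>2"
    and "incidence_matrix N \<Phi> edge \<nu> \<Psi>2 E"
    and "\<phi>b \<in> dual_bnd_space N xi \<Omega> \<Phi> edge \<nu> bnd \<Psi>1"
    and "q \<in> D_space N \<Phi>"
    and "\<forall>p \<in> D_space N \<Phi>.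
           L2_inner \<Omega> (divg p) (divg q) + L2_inner \<Omega> p q
             = bnd_integral N xi \<Omega> \<Phi> (\<lambda>x. normal_trace \<Phi> p x * \<phi>b x)"
    and "\<phi> \<in> S_space N \<Phi>"
    and "\<forall>\<eta> \<in> S_space N \<Phi>.
           L2_inner \<Omega> (dual_grad N xi \<Omega> \<Phi> \<eta> (\<lambda>_. 0)) (dual_grad N xi \<Omega> \<Phi> \<phi> \<phi>b)
             + L2_inner \<Omega> \<eta> \<phi> = 0"
  shows "(\<forall>x \<in> broken \<Phi>. \<phi> x = divg q x) \<and>
         dual_dof0 \<Omega> cell \<Psi>2 \<phi> = (mass_matrix \<Omega> \<Psi>2 ** E) *v dof1 \<Phi> edge \<nu> q \<and>
         dual_bnd_norm N xi \<Omega> \<Phi> \<phi>b = Hgrad_norm N xi \<Omega> \<Phi> \<phi> \<phi>b \<and>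
         Hgrad_norm N xi \<Omega> \<Phi> \<phi> \<phi>b = Hdiv_norm \<Omega> q"
proof -
  interpret discretization \<Omega> \<Phi> N xi edge \<nu> cell \<Psi>1 \<Psi>2 E
    by unfold_locales (rule assms)+
  have \<phi>b: "bounded_borel_on (frontier \<Omega> - vertices \<Phi>) \<phi>b"
    by (rule dual_bnd_space_bounded_borel[OF assms(12) dof_basis_in[OF basis1]])
  note duality = neumann_dirichlet_duality[OF \<phi>b assms(13-16)]
  \<comment> \<open>Both vectors are coefficients of one function on \<open>broken \<Phi>\<close>;
    multiplying by the mass matrix then gives the dual degrees of freedom.\<close>
  have "dof2 cell \<phi> = E *v dof1 \<Phi> edge \<nu> q"
  proof (rule dof_basis_unique[OF basis2])
    fix x assume x: "x \<in> broken \<Phi>"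
    show "(\<Sum>c\<in>UNIV. dof2 cell \<phi> $ c *\<^sub>R \<Psi>2 c x) = (\<Sum>c\<in>UNIV. (E *v dof1 \<Phi> edge \<nu> q) $ c *\<^sub>R \<Psi>2 c x)"
      unfolding dof_basis_expand[OF basis2 assms(15) x, symmetric] divg_expand[OF assms(13) x, symmetric]
      by (rule duality(1)[OF x])
  qed
  then have "dual_dof0 \<Omega> cell \<Psi>2 \<phi> = (mass_matrix \<Omega> \<Psi>2 ** E) *v dof1 \<Phi> edge \<nu> q"
    by (simp add: dual_dof0_def matrix_vector_mul_assoc)
  \<comment> \<open>\<open>\<phi>\<close> is itself a competitor, so the infimum is
    attained.\<close>
  moreover have "dual_bnd_norm N xi \<Omega> \<Phi> \<phi>b = Hgrad_norm N xi \<Omega> \<Phi> \<phi> \<phi>b"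
    unfolding dual_bnd_norm_def
    by (rule cInf_eq_minimum) (use assms(15) duality(3) in auto)
  moreover have "L2_inner \<Omega> \<phi> \<phi> = L2_inner \<Omega> (divg q) (divg q)"
    by (rule inner_cong[OF duality(1) duality(1)])
  moreover have "L2_inner \<Omega> (dual_grad N xi \<Omega> \<Phi> \<phi> \<phi>b) (dual_grad N xi \<Omega> \<Phi> \<phi> \<phi>b) = L2_inner \<Omega> q q"
    by (rule inner_cong[OF duality(2) duality(2)])
  ultimately show ?thesis
    using duality(1) unfolding Hgrad_norm_def Hdiv_norm_def L2_norm_power2 by (simp add: add.commute)
qed

end
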